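(* Let $N\ge 3$ and $2\le\tilde N\le N-1$. Consider the system $x_{k+1}=f(x_k,u_k,w_k)$ and the partially constrained stochastic MPC problem with value function $V_{N,\tilde N}$ described in the context. Suppose that the disturbances are i.i.d., that $f$ is continuous with $f(0,0,0)=0$, and that the viability assumption (with compact set $\mathcal X_\delta$) and the cost controllability assumption (with constants $C_1,C_2>0$, $\sigma_1,\sigma_2\in(0,1)$ and terms $\ell^0_0,\dots,\ell^0_N$), both stated in the context, hold. Define $$\alpha = 1-C_1C_2\,\sigma_1^{N-\tilde N+1}\left(\frac{1-\sigma_2^{\tilde N}}{1-\sigma_2}\right),\qquad c_2=\max\left\{1,\;C_2\sigma_1\frac{1-\sigma_2^{\tilde N}}{1-\sigma_2}\right\}\left(\sum_{i=0}^{N}\ell^0_i\right).$$ Provided that $\alpha\in(0,1)$, for all $x_k\in\mathcal X_\delta$ $$\mathbb E_{\mathbb P}\big[V_{N,\tilde N}(f(x_k,u^\star_{0|k}(x_k),w_k))\,\big|\,x_k\big]-V_{N,\tilde N}(x_k)\le-\alpha\,\ell(x_k,u^\star_{0|k}(x_k))+c_2,$$ and hence, for $x_0\in\mathcal X_\delta$, the average expected infinite-horizon closed-loop cost satisfies $\bar J_\infty^{N,\tilde N}(x_0)\le c_2/\alpha$.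
   Context: **System.** $x_{k+1}=f(x_k,u_k,w_k)$ with state $x_k\in\mathbb R^{n_x}$, input $u_k\in\mathbb R^m$, disturbance $w_k\in\mathcal W\subset\mathbb R^d$, $\mathcal W$ compact; $f:\mathbb R^{n_x}\times\mathbb R^m\times\mathbb R^d\to\mathbb R^{n_x}$ is continuous with $f(0,0,0)=0$. The random vectors $W_k$, $k\ge0$, are i.i.d. with distribution $\mathbb P$ on $\mathcal W$; $w_k$ is the disturbance realization at time $k$. $\mathcal U$ is the (hard) input constraint set, $\mathcal X$ the state constraint set, $\varepsilon\in(0,1)$, and the stage cost $\ell:\mathbb R^{n_x}\times\mathbb R^m\to\mathbb R_{\ge0}$ is continuous and positive definite. Control policies are non-anticipative. **Predictions.** From a measured state $x_k$, predicted states are the random variables $x_{0|k}=x_k$ almost surely, $x_{i+1|k}=f(x_{i|k},u_{i|k},W_{k+i})$. **MPC problem.** $$V_{N,\tilde N}(x_k)=\min_{u_{0|k},\dots,u_{N-1|k}}\ \mathbb E_{\mathbb P}\Big[\sum_{i=0}^{N-1}\ell(x_{i|k},u_{i|k})\,\Big|\,x_k\Big]$$ subject to the prediction dynamics, $x_{0|k}=x_k$, $u_{i|k}\in\mathcal U$ for $i=0,\dots,N-1$, and the chance constraints $\mathbb P\{x_{i+1|k}\in\mathcal X\mid x_{i|k}\}\ge1-\varepsilon$ for $i=0,\dots,N-\tilde N$ only. The minimizer is denoted $u^\star_{0|k},\dots,u^\star_{N-1|k}$, with corresponding predicted states $x^\star_{i|k}$ (so $x^\star_{0|k}=x_k$).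 The control mappings are restricted to a parameterized (generally suboptimal) class: they admit a finite-dimensional parametrization $u^\star_{i|k}(x_{i|k},v_{i|k})$, $i=0,\dots,N-1$, where $v_{i|k}\in\mathbb R^m$ is a state-independent optimization parameter; optimizing over $u$ means optimizing over $v$. **Closed loop.** At each time $k$ the problem is solved and $u^\star_{0|k}(x_k)$ is applied: $x_{k+1}=f(x_k,u^\star_{0|k}(x_k),w_k)$. The average expected infinite-horizon closed-loop cost is $$\bar J_\infty^{N,\tilde N}(x_0)=\limsup_{m\to\infty}\frac1m\sum_{k=0}^{m-1}\mathbb E_{\mathbb P}\big[\ell(x^\star_{0|k},u^\star_{0|k}(x_k))\big].$$ **Tail problem.** $V_{\tilde N,\tilde N}$ is the value function of the $\tilde N$-stage problem: minimize the expected sum of $\tilde N$ stage costs from a given initial state, under the prediction dynamics, with all $\tilde N$ inputs in $\mathcal U$ and the chance constraint (successor state in $\mathcal X$ with conditional probability at least $1-\varepsilon$ given the current state) imposed at the first of the $\tilde N$ steps only. When it is evaluated at the predicted random state $x^\star_{N-\tilde N+1|k}$, the expectation in its definition remains conditioned on $x_k$. **Viability assumption.** There exists a compact robust control invariant set $\mathcal X_\delta\subseteq\mathcal X$ such that for all $x_k\in\mathcal X_\delta$, $2\le\tilde N\le N$ and $w\in\mathcal W$: $f(x_k,u^\star_{0|k},w)\in\mathcal X_\delta$ and $V_{N,\tilde N}(x_k)$ is attained, with $V_{N,\tilde N}$ continuous on $\mathcal X_\delta$. **Cost controllability assumption** (for each fixed pair $(N,\tilde N)$). Write $\lambda_{s_1}[(n,k)|x_k]=\mathbb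 E_{\mathbb P}[\ell(x^\star_{n|k},u^\star_{n|k})\mid x_k]$ for $n=0,\dots,N-\tilde N$. There exist constants $C_1>0$, $\sigma_1\in(0,1)$, independent of $x_k$, such that for all $x_k\in\mathcal X_\delta$ $$\lambda_{s_1}[(N-\tilde N,k)|x_k]\le C_1\sigma_1^{N-\tilde N}\,\ell(x^\star_{0|k},u^\star_{0|k})+\ell^0_{N-\tilde N}.$$ Moreover there exist constants $C_2>0$, $\sigma_2\in(0,1)$, independent of $x_k$, such that for all $x_k\in\mathcal X_\delta$ there exists a state/control pair $\{\tilde x_{N-\tilde N+1+j|k},\tilde u_{N-\tilde N+1+j|k}\}_{j=0}^{\tilde N-1}$ admissible for the corresponding $\tilde N$-stage tail problem, starting at $\tilde x_{N-\tilde N+1|k}=x^\star_{N-\tilde N+1|k}$, such that for $j=0,\dots,\tilde N-1$ $$\mathbb E_{\mathbb P}\big[\ell(\tilde x_{N-\tilde N+1+j|k},\tilde u_{N-\tilde N+1+j|k})\mid x_k\big]\le C_2\sigma_1\sigma_2^{j}\,\lambda_{s_1}[(N-\tilde N,k)|x_k]+\ell^0_{N-\tilde N+1+j}+\Delta^0_{N-\tilde N}.$$ Here $\ell^0_i=\mathbb E_{\mathbb P}[\ell(x^\star_{i|k},u^\star_{i|k})\mid x_k]$ when $x^\star_{0|k}=0$, for $i=0,\dots,N-\tilde N$; $\ell^0_{N-\tilde N+1+j}=\mathbb E_{\mathbb P}[\ell(\tilde x^\star_{N-\tilde N+1+j|k},\tilde u^\star_{N-\tilde N+1+j|k})\mid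 x_k]$ for $j=0,\dots,\tilde N-1$, where $(\tilde x^\star,\tilde u^\star)$ denotes an optimizer of the problem $V_{\tilde N,\tilde N}(x^\star_{N-\tilde N+1|k})$ when $x^\star_{0|k}=0$; and $\Delta^0_{N-\tilde N}=\frac1{\tilde N}\sum_{r=0}^{N-\tilde N-1}\ell^0_r$. *)

theory Defs
  imports "HOL-Probability.Probability"
begin

text \<open>
  Data of the stochastic control problem.  The field \<open>policy\<close> is the finite-dimensional
  parametrization of the control mappings: a parameter \<open>v\<close>, which does not depend on the state,
  selects the feedback \<open>\<lambda>x. policy S (x, v)\<close>.  The same class is used at every stage, so a tail
  of a policy sequence is again a policy sequence.
\<close>

record ('n, 'm, 'd, 'o) smpc =
  prob_sp :: "'o measure"
  noise :: "nat \<Rightarrow> 'o \<Rightarrow> real ^ 'd"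
  noise_set :: "(real ^ 'd) set"
  noise_law :: "(real ^ 'd) measure"
  dyn :: "(real ^ 'n) \<times> (real ^ 'm) \<times> (real ^ 'd) \<Rightarrow> real ^ 'n"
  stage_cost :: "(real ^ 'n) \<times> (real ^ 'm) \<Rightarrow> real"
  policy :: "(real ^ 'n) \<times> (real ^ 'm) \<Rightarrow> real ^ 'm"
  input_set :: "(real ^ 'm) set"
  state_set :: "(real ^ 'n) set"
  risk :: real

definition iid_noise :: "('n::finite, 'm::finite, 'd::finite, 'o) smpc \<Rightarrow> bool" where
  "iid_noise S \<longleftrightarrow>
     prob_space (prob_sp S) \<and>
     compact (noise_set S) \<and>
     space (noise_law S) = noise_set S \<and>
     sets (noise_law S) = sets (restrict_space borel (noise_set S)) \<and>
     prob_space.indep_vars (prob_sp S) (\<lambda>_. noise_law S) (noise S) UNIV \<and>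
     (\<forall>k. distr (prob_sp S) (noise_law S) (noise S k) = noise_law S)"

definition smpc_setup :: "('n::finite, 'm::finite, 'd::finite, 'o) smpc \<Rightarrow> bool" where
  "smpc_setup S \<longleftrightarrow>
     iid_noise S \<and>
     continuous_on UNIV (dyn S) \<and> dyn S (0, 0, 0) = 0 \<and>
     continuous_on UNIV (stage_cost S) \<and>
     (\<forall>z. 0 \<le> stage_cost S z) \<and> (\<forall>z. stage_cost S z = 0 \<longleftrightarrow> z = 0) \<and>
     (\<forall>v. (\<lambda>x. policy S (x, v)) \<in> borel_measurable borel) \<and>
     input_set S \<in> sets borel \<and> state_set S \<in> sets borel \<and>
     0 < risk S \<and> risk S < 1"

text \<open>
  Predictions started at time \<open>t\<close> from the initial random state \<open>\<xi>\<close>, under the parameter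
  sequence \<open>v\<close>.  For a measured state \<open>x\<close> one takes \<open>\<xi>\<close> constant, so that expectations conditioned
  on the measured state are plain expectations; the tail problem has a genuinely random \<open>\<xi>\<close>.
\<close>

primrec pred_state :: "('n::finite, 'm::finite, 'd::finite, 'o) smpc \<Rightarrow> nat \<Rightarrow> ('o \<Rightarrow> real ^ 'n)
    \<Rightarrow> (nat \<Rightarrow> real ^ 'm) \<Rightarrow> nat \<Rightarrow> 'o \<Rightarrow> real ^ 'n" where
  "pred_state S t \<xi> v 0 \<omega> = \<xi> \<omega>"
| "pred_state S t \<xi> v (Suc i) \<omega> =
     dyn S (pred_state S t \<xi> v i \<omega>, policy S (pred_state S t \<xi> v i \<omega>, v i), noise S (t + i) \<omega>)"

definition pred_input :: "('n::finite, 'm::finite, 'd::finite, 'o) smpc \<Rightarrow> nat \<Rightarrow> ('o \<Rightarrow> real ^ 'n)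
    \<Rightarrow> (nat \<Rightarrow> real ^ 'm) \<Rightarrow> nat \<Rightarrow> 'o \<Rightarrow> real ^ 'm" where
  "pred_input S t \<xi> v i \<omega> = policy S (pred_state S t \<xi> v i \<omega>, v i)"

definition pred_stage_cost :: "('n::finite, 'm::finite, 'd::finite, 'o) smpc \<Rightarrow> nat
    \<Rightarrow> ('o \<Rightarrow> real ^ 'n) \<Rightarrow> (nat \<Rightarrow> real ^ 'm) \<Rightarrow> nat \<Rightarrow> 'o \<Rightarrow> real" where
  "pred_stage_cost S t \<xi> v i \<omega> = stage_cost S (pred_state S t \<xi> v i \<omega>, pred_input S t \<xi> v i \<omega>)"

definition cond_prob_given :: "'o measure \<Rightarrow> ('o \<Rightarrow> real ^ 'n::finite) \<Rightarrow> 'o set \<Rightarrow> 'o \<Rightarrow> real" where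
  "cond_prob_given M Y A = real_cond_exp M (vimage_algebra (space M) Y borel) (indicator A)"

definition chance_constraint :: "('n::finite, 'm::finite, 'd::finite, 'o) smpc \<Rightarrow> nat
    \<Rightarrow> ('o \<Rightarrow> real ^ 'n) \<Rightarrow> (nat \<Rightarrow> real ^ 'm) \<Rightarrow> nat \<Rightarrow> bool" where
  "chance_constraint S t \<xi> v i \<longleftrightarrow>
     (AE \<omega> in prob_sp S. 1 - risk S \<le>
        cond_prob_given (prob_sp S) (pred_state S t \<xi> v i)
          {\<omega> \<in> space (prob_sp S). pred_state S t \<xi> v (Suc i) \<omega> \<in> state_set S} \<omega>)"

text \<open>
  The integrability clause makes the objective a well-defined real number (the Bochner integral
  of a non-integrable function is \<open>0\<close> by convention).  With \<open>Nt = N\<close> the chance constraint is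
  imposed at the first step only, as in the tail problem.
\<close>

definition admissible :: "('n::finite, 'm::finite, 'd::finite, 'o) smpc \<Rightarrow> nat \<Rightarrow> nat \<Rightarrow> nat
    \<Rightarrow> ('o \<Rightarrow> real ^ 'n) \<Rightarrow> (nat \<Rightarrow> real ^ 'm) \<Rightarrow> bool" where
  "admissible S N Nt t \<xi> v \<longleftrightarrow>
     (\<forall>i<N. AE \<omega> in prob_sp S. pred_input S t \<xi> v i \<omega> \<in> input_set S) \<and>
     (\<forall>i<N. integrable (prob_sp S) (pred_stage_cost S t \<xi> v i)) \<and>
     (\<forall>i\<le>N - Nt. chance_constraint S t \<xi> v i)"

definition objective :: "('n::finite, 'm::finite, 'd::finite, 'o) smpc \<Rightarrow> nat \<Rightarrow> nat
    \<Rightarrow> ('o \<Rightarrow> real ^ 'n) \<Rightarrow> (nat \<Rightarrow> real ^ 'm) \<Rightarrow> real" where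
  "objective S N t \<xi> v = (\<integral>\<omega>. (\<Sum>i<N. pred_stage_cost S t \<xi> v i \<omega>) \<partial>prob_sp S)"

definition optimizer :: "('n::finite, 'm::finite, 'd::finite, 'o) smpc \<Rightarrow> nat \<Rightarrow> nat \<Rightarrow> nat
    \<Rightarrow> ('o \<Rightarrow> real ^ 'n) \<Rightarrow> (nat \<Rightarrow> real ^ 'm) \<Rightarrow> bool" where
  "optimizer S N Nt t \<xi> v \<longleftrightarrow> is_arg_min (objective S N t \<xi>) (admissible S N Nt t \<xi>) v"

text \<open>
  Value of the problem solved at time \<open>k\<close> in the measured state \<open>x\<close>.  The index \<open>k\<close> only says
  which disturbances enter the predictions; under \<open>iid_noise\<close> the value does not depend on it.
\<close>

definition val_fun :: "('n::finite, 'm::finite, 'd::finite, 'o) smpc \<Rightarrow> nat \<Rightarrow> nat \<Rightarrow> nat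
    \<Rightarrow> real ^ 'n \<Rightarrow> real" where
  "val_fun S N Nt k x =
     (INF v\<in>{v. admissible S N Nt k (\<lambda>_. x) v}. objective S N k (\<lambda>_. x) v)"

text \<open>
  In the following, \<open>vs k x\<close> is the chosen optimal parameter sequence for the problem solved at
  time \<open>k\<close> in state \<open>x\<close> (optimizers need not be unique).
\<close>

definition mpc_input :: "('n::finite, 'm::finite, 'd::finite, 'o) smpc
    \<Rightarrow> (nat \<Rightarrow> real ^ 'n \<Rightarrow> nat \<Rightarrow> real ^ 'm) \<Rightarrow> nat \<Rightarrow> real ^ 'n \<Rightarrow> real ^ 'm" where
  "mpc_input S vs k x = policy S (x, vs k x 0)"

primrec closed_loop :: "('n::finite, 'm::finite, 'd::finite, 'o) smpc
    \<Rightarrow> (nat \<Rightarrow> real ^ 'n \<Rightarrow> nat \<Rightarrow> real ^ 'm) \<Rightarrow> real ^ 'n \<Rightarrow> nat \<Rightarrow> 'o \<Rightarrow> real ^ 'n" where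
  "closed_loop S vs x0 0 \<omega> = x0"
| "closed_loop S vs x0 (Suc k) \<omega> =
     dyn S (closed_loop S vs x0 k \<omega>, mpc_input S vs k (closed_loop S vs x0 k \<omega>), noise S k \<omega>)"

definition avg_closed_loop_cost :: "('n::finite, 'm::finite, 'd::finite, 'o) smpc
    \<Rightarrow> (nat \<Rightarrow> real ^ 'n \<Rightarrow> nat \<Rightarrow> real ^ 'm) \<Rightarrow> real ^ 'n \<Rightarrow> ereal" where
  "avg_closed_loop_cost S vs x0 =
     limsup (\<lambda>m. ereal (1 / real m * (\<Sum>k<m. \<integral>\<omega>.
       stage_cost S (closed_loop S vs x0 k \<omega>, mpc_input S vs k (closed_loop S vs x0 k \<omega>))
       \<partial>prob_sp S)))"

definition robust_control_invariant :: "('n::finite, 'm::finite, 'd::finite, 'o) smpc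
    \<Rightarrow> (real ^ 'n) set \<Rightarrow> bool" where
  "robust_control_invariant S A \<longleftrightarrow>
     (\<forall>x\<in>A. \<exists>u\<in>input_set S. \<forall>w\<in>noise_set S. dyn S (x, u, w) \<in> A)"

text \<open>Here \<open>vs Nt\<close> is the choice of optimizers for the horizon pair \<open>(N, Nt)\<close>.\<close>

definition viable :: "('n::finite, 'm::finite, 'd::finite, 'o) smpc \<Rightarrow> nat
    \<Rightarrow> (nat \<Rightarrow> nat \<Rightarrow> real ^ 'n \<Rightarrow> nat \<Rightarrow> real ^ 'm) \<Rightarrow> (real ^ 'n) set \<Rightarrow> bool" where
  "viable S N vs Xd \<longleftrightarrow>
     compact Xd \<and> Xd \<subseteq> state_set S \<and> robust_control_invariant S Xd \<and>
     (\<forall>Nt k. 2 \<le> Nt \<and> Nt \<le> N \<longrightarrow>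
        (\<forall>x\<in>Xd. optimizer S N Nt k (\<lambda>_. x) (vs Nt k x) \<and>
           (\<forall>w\<in>noise_set S. dyn S (x, mpc_input S (vs Nt) k x, w) \<in> Xd)) \<and>
        continuous_on Xd (val_fun S N Nt k))"

definition opt_stage_cost :: "('n::finite, 'm::finite, 'd::finite, 'o) smpc
    \<Rightarrow> (nat \<Rightarrow> real ^ 'n \<Rightarrow> nat \<Rightarrow> real ^ 'm) \<Rightarrow> nat \<Rightarrow> nat \<Rightarrow> real ^ 'n \<Rightarrow> real" where
  "opt_stage_cost S vs n k x = (\<integral>\<omega>. pred_stage_cost S k (\<lambda>_. x) (vs k x) n \<omega> \<partial>prob_sp S)"

definition tail_start :: "('n::finite, 'm::finite, 'd::finite, 'o) smpc \<Rightarrow> nat \<Rightarrow> nat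
    \<Rightarrow> (nat \<Rightarrow> real ^ 'n \<Rightarrow> nat \<Rightarrow> real ^ 'm) \<Rightarrow> nat \<Rightarrow> real ^ 'n \<Rightarrow> 'o \<Rightarrow> real ^ 'n" where
  "tail_start S N Nt vs k x = pred_state S k (\<lambda>_. x) (vs k x) (N - Nt + 1)"

definition tail_stage_cost :: "('n::finite, 'm::finite, 'd::finite, 'o) smpc \<Rightarrow> nat \<Rightarrow> nat
    \<Rightarrow> (nat \<Rightarrow> real ^ 'n \<Rightarrow> nat \<Rightarrow> real ^ 'm) \<Rightarrow> nat \<Rightarrow> real ^ 'n \<Rightarrow> (nat \<Rightarrow> real ^ 'm)
    \<Rightarrow> nat \<Rightarrow> real" where
  "tail_stage_cost S N Nt vs k x v j =
     (\<integral>\<omega>. pred_stage_cost S (k + (N - Nt + 1)) (tail_start S N Nt vs k x) v j \<omega> \<partial>prob_sp S)"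

text \<open>The terms \<open>\<ell>\<^sup>0\<^sub>0, \<dots>, \<ell>\<^sup>0\<^sub>N\<close>, generated by the problem solved at the origin.\<close>

definition origin_costs :: "('n::finite, 'm::finite, 'd::finite, 'o) smpc \<Rightarrow> nat \<Rightarrow> nat
    \<Rightarrow> (nat \<Rightarrow> real ^ 'n \<Rightarrow> nat \<Rightarrow> real ^ 'm) \<Rightarrow> (nat \<Rightarrow> real) \<Rightarrow> bool" where
  "origin_costs S N Nt vs l0 \<longleftrightarrow>
     (\<forall>k. optimizer S N Nt k (\<lambda>_. 0) (vs k 0) \<and>
        (\<forall>i\<le>N - Nt. l0 i = opt_stage_cost S vs i k 0) \<and>
        (\<exists>v. optimizer S Nt Nt (k + (N - Nt + 1)) (tail_start S N Nt vs k 0) v \<and>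
           (\<forall>j<Nt. l0 (N - Nt + 1 + j) = tail_stage_cost S N Nt vs k 0 v j)))"

definition cost_controllable :: "('n::finite, 'm::finite, 'd::finite, 'o) smpc \<Rightarrow> nat \<Rightarrow> nat
    \<Rightarrow> (nat \<Rightarrow> real ^ 'n \<Rightarrow> nat \<Rightarrow> real ^ 'm) \<Rightarrow> (real ^ 'n) set
    \<Rightarrow> real \<Rightarrow> real \<Rightarrow> real \<Rightarrow> real \<Rightarrow> (nat \<Rightarrow> real) \<Rightarrow> bool" where
  "cost_controllable S N Nt vs Xd C1 \<sigma>1 C2 \<sigma>2 l0 \<longleftrightarrow>
     0 < C1 \<and> 0 < \<sigma>1 \<and> \<sigma>1 < 1 \<and> 0 < C2 \<and> 0 < \<sigma>2 \<and> \<sigma>2 < 1 \<and>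
     origin_costs S N Nt vs l0 \<and>
     (\<forall>k. \<forall>x\<in>Xd.
        opt_stage_cost S vs (N - Nt) k x
          \<le> C1 * \<sigma>1 ^ (N - Nt) * stage_cost S (x, mpc_input S vs k x) + l0 (N - Nt) \<and>
        (\<exists>v. admissible S Nt Nt (k + (N - Nt + 1)) (tail_start S N Nt vs k x) v \<and>
           (\<forall>j<Nt. tail_stage_cost S N Nt vs k x v j
              \<le> C2 * \<sigma>1 * \<sigma>2 ^ j * opt_stage_cost S vs (N - Nt) k x
                + l0 (N - Nt + 1 + j) + 1 / real Nt * (\<Sum>r<N - Nt. l0 r))))"

end

theory Submission
  imports Defs
begin

text \<open>
  Idea: after one step from \<open>x\<close>, the remaining optimal parameters up to stage \<open>N - Nt\<close>, followed by
  the parameters supplied by cost controllability, form a candidate for the next problem started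
  at the random successor state.  Since \<open>noise S k\<close> is independent of the later disturbances, the
  Markov property turns admissibility from a random state into admissibility from almost every
  realization of it, and turns the expected candidate cost into the average of the candidate
  costs from these realizations.  So the expected next value is at most the candidate cost,
  which is the old value minus the first stage cost plus at most the tail cost; the tail cost is
  bounded by the geometric estimates.  The bound on the average cost is the telescoped descent
  inequality, integrated along the closed loop.

  Admissibility and cost only involve the laws of single predicted states, so the Markov property
  is only needed for one-time marginals.
\<close>

lemma sum_lessThan_add:
  fixes g :: "nat \<Rightarrow> 'a::comm_monoid_add"
  shows "(\<Sum>i<m + n. g i) = (\<Sum>i<m. g i) + (\<Sum>j<n. g (m + j))"
  by (induction n) (simp_all add: add.assoc)

section \<open>Freezing an independent variable\<close>

text \<open>The library's \<open>indep_var\<close> forces both variables to take values in the same type.\<close>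

definition (in prob_space) indep_pair :: "'b measure \<Rightarrow> ('a \<Rightarrow> 'b) \<Rightarrow> 'c measure \<Rightarrow> ('a \<Rightarrow> 'c) \<Rightarrow> bool"
  where "indep_pair N Y L W \<longleftrightarrow> Y \<in> M \<rightarrow>\<^sub>M N \<and> W \<in> M \<rightarrow>\<^sub>M L \<and>
    distr M N Y \<Otimes>\<^sub>M distr M L W = distr M (N \<Otimes>\<^sub>M L) (\<lambda>\<omega>. (Y \<omega>, W \<omega>))"

text \<open>The product of the image laws is the image of the product law under the product map, and
  by independence that product law is the joint law.\<close>

lemma (in prob_space) indep_pair_compose:
  assumes "indep_pair N Y L W" and f[measurable]: "f \<in> N \<rightarrow>\<^sub>M N'" and g[measurable]: "g \<in> L \<rightarrow>\<^sub>M L'"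
  shows "indep_pair N' (\<lambda>\<omega>. f (Y \<omega>)) L' (\<lambda>\<omega>. g (W \<omega>))"
proof -
  have Y[measurable]: "Y \<in> M \<rightarrow>\<^sub>M N" and W[measurable]: "W \<in> M \<rightarrow>\<^sub>M L"
    and eq: "distr M N Y \<Otimes>\<^sub>M distr M L W = distr M (N \<Otimes>\<^sub>M L) (\<lambda>\<omega>. (Y \<omega>, W \<omega>))"
    using assms(1) by (auto simp: indep_pair_def)
  have "prob_space (distr (distr M L W) L' g)"
    by (intro prob_space.prob_space_distr prob_space_distr) simp_all
  then have "distr (distr M N Y) N' f \<Otimes>\<^sub>M distr (distr M L W) L' g =
      distr (distr M N Y \<Otimes>\<^sub>M distr M L W) (N' \<Otimes>\<^sub>M L') (\<lambda>(x, y). (f x, g y))"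
    by (intro pair_measure_distr) (simp_all add: prob_space_imp_sigma_finite)
  also have "\<dots> = distr M (N' \<Otimes>\<^sub>M L') (\<lambda>\<omega>. (f (Y \<omega>), g (W \<omega>)))"
    unfolding eq by (subst distr_distr) (simp_all add: comp_def)
  finally show ?thesis
    by (simp add: indep_pair_def distr_distr comp_def)
qed

text \<open>Independence makes the joint law a product measure, so Tonelli's theorem integrates
  \<open>W\<close> out first with the value of \<open>Y\<close> frozen.\<close>

lemma (in prob_space) nn_integral_indep_pair:
  assumes ind: "indep_pair N Y L W" and \<phi>: "\<phi> \<in> borel_measurable (N \<Otimes>\<^sub>M L)"
  shows "(\<integral>\<^sup>+\<omega>. \<phi> (Y \<omega>, W \<omega>) \<partial>M) = (\<integral>\<^sup>+\<omega>. (\<integral>\<^sup>+w. \<phi> (Y \<omega>, w) \<partial>distr M L W) \<partial>M)"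
proof -
  have Y[measurable]: "Y \<in> M \<rightarrow>\<^sub>M N" and W[measurable]: "W \<in> M \<rightarrow>\<^sub>M L"
    and eq: "distr M N Y \<Otimes>\<^sub>M distr M L W = distr M (N \<Otimes>\<^sub>M L) (\<lambda>\<omega>. (Y \<omega>, W \<omega>))"
    using ind by (auto simp: indep_pair_def)
  interpret W: prob_space "distr M L W" by (rule prob_space_distr[OF W])
  have \<phi>'[measurable]: "\<phi> \<in> borel_measurable (N \<Otimes>\<^sub>M distr M L W)"
    using \<phi> by (simp cong: measurable_cong_sets sets_pair_measure_cong)
  have \<phi>'': "\<phi> \<in> borel_measurable (distr M N Y \<Otimes>\<^sub>M distr M L W)"
    using \<phi> by (simp cong: measurable_cong_sets sets_pair_measure_cong)
  have "(\<integral>\<^sup>+\<omega>. \<phi> (Y \<omega>, W \<omega>) \<partial>M) = (\<integral>\<^sup>+p. \<phi> p \<partial>(distr M N Y \<Otimes>\<^sub>M distr M L W))"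
    using \<phi> by (simp add: eq nn_integral_distr)
  also have "\<dots> = (\<integral>\<^sup>+y. (\<integral>\<^sup>+w. \<phi> (y, w) \<partial>distr M L W) \<partial>distr M N Y)"
    by (rule W.nn_integral_fst[symmetric, OF \<phi>''])
  also have "\<dots> = (\<integral>\<^sup>+\<omega>. (\<integral>\<^sup>+w. \<phi> (Y \<omega>, w) \<partial>distr M L W) \<partial>M)"
    by (rule nn_integral_distr[OF Y]) measurable
  finally show ?thesis .
qed

text \<open>Conditioning on \<open>Y\<close> freezes its value and leaves the law of
  \<open>W\<close> unchanged. The resulting function of \<open>Y\<close> has the two properties
  characterizing the conditional expectation: it is measurable for the sigma-algebra generated by
  \<open>Y\<close>, and it has the right integral over every set of that sigma-algebra.\<close>

lemma (in prob_space) cond_prob_given_indep_pair: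
  fixes Y :: "'a \<Rightarrow> real ^ 'n::finite"
  assumes ind: "indep_pair borel Y L W" and F[measurable]: "F \<in> borel \<Otimes>\<^sub>M L \<rightarrow>\<^sub>M K"
    and X[measurable]: "X \<in> sets K"
  shows "AE \<omega> in M. cond_prob_given M Y {\<omega> \<in> space M. F (Y \<omega>, W \<omega>) \<in> X} \<omega>
    = measure (distr M L W) {w \<in> space L. F (Y \<omega>, w) \<in> X}"
proof -
  have Y[measurable]: "Y \<in> M \<rightarrow>\<^sub>M borel" and W[measurable]: "W \<in> M \<rightarrow>\<^sub>M L"
    using ind by (auto simp: indep_pair_def)
  interpret W: prob_space "distr M L W" by (rule prob_space_distr[OF W])
  define G where "G = vimage_algebra (space M) Y borel"
  have "subalgebra M G"
    unfolding subalgebra_def G_def using Y by (auto simp: sets_vimage_algebra2)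
  then interpret G: finite_measure_subalgebra M G by unfold_locales
  \<comment> \<open>\<open>\<kappa>\<close> and \<open>p\<close> are the same probability: the
    extended nonnegative form fits Tonelli's theorem and gives measurability, the real form is the
    one to be identified.\<close>
  define \<kappa> where "\<kappa> y = (\<integral>\<^sup>+w. indicator X (F (y, w)) \<partial>distr M L W)" for y
  define p where "p y = measure (distr M L W) {w \<in> space L. F (y, w) \<in> X}" for y
  have \<kappa>_meas[measurable]: "\<kappa> \<in> borel_measurable borel"
    unfolding \<kappa>_def by measurable
  have \<kappa>_p: "\<kappa> y = ennreal (p y)" for y
  proof -
    have "\<kappa> y = (\<integral>\<^sup>+w. indicator {w \<in> space L. F (y, w) \<in> X} w \<partial>distr M L W)"
      unfolding \<kappa>_def by (intro nn_integral_cong) (auto split: split_indicator)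
    also have "\<dots> = emeasure (distr M L W) {w \<in> space L. F (y, w) \<in> X}"
      by (intro nn_integral_indicator) measurable
    finally show ?thesis by (simp add: p_def W.emeasure_eq_measure)
  qed
  have p_nonneg: "0 \<le> p y" and p_le: "p y \<le> 1" for y
    by (auto simp: p_def)
  have "p = (\<lambda>y. enn2real (\<kappa> y))" by (auto simp: \<kappa>_p p_nonneg)
  then have p_meas[measurable]: "p \<in> borel_measurable borel" by simp
  have YG: "Y \<in> G \<rightarrow>\<^sub>M borel"
    unfolding G_def by (rule measurable_vimage_algebra1) simp
  let ?A = "{\<omega> \<in> space M. F (Y \<omega>, W \<omega>) \<in> X}"
  have "AE \<omega> in M. real_cond_exp M G (indicator ?A) \<omega> = p (Y \<omega>)"
  proof (rule G.real_cond_exp_charact)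
    fix B assume "B \<in> sets G"
    then obtain C where C[measurable]: "C \<in> sets borel" and B: "B = Y -` C \<inter> space M"
      unfolding G_def by (auto simp: sets_vimage_algebra2)
    \<comment> \<open>Sets of \<open>G\<close> are preimages under \<open>Y\<close>, so their
      indicator is frozen along with \<open>Y\<close> and leaves the inner integral as a constant
      factor.\<close>
    have "(\<integral>\<^sup>+\<omega>. indicator C (Y \<omega>) * indicator X (F (Y \<omega>, W \<omega>)) \<partial>M) =
       (\<integral>\<^sup>+\<omega>. (\<integral>\<^sup>+w. indicator C (Y \<omega>) * indicator X (F (Y \<omega>, w)) \<partial>distr M L W) \<partial>M)"
      using nn_integral_indep_pair[OF ind, of "\<lambda>q. indicator C (fst q) * indicator X (F q)"]
      by simp
    also have "\<dots> = (\<integral>\<^sup>+\<omega>. indicator C (Y \<omega>) * \<kappa> (Y \<omega>) \<partial>M)"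
      unfolding \<kappa>_def by (intro nn_integral_cong nn_integral_cmult) measurable
    finally have eq: "(\<integral>\<^sup>+\<omega>. indicator C (Y \<omega>) * indicator X (F (Y \<omega>, W \<omega>)) \<partial>M) =
      (\<integral>\<^sup>+\<omega>. indicator C (Y \<omega>) * \<kappa> (Y \<omega>) \<partial>M)" .
    have "(\<integral>\<omega>\<in>B. indicator ?A \<omega> \<partial>M) = enn2real (\<integral>\<^sup>+\<omega>. ennreal (indicator B \<omega> * indicator ?A \<omega>) \<partial>M)"
      unfolding set_lebesgue_integral_def B real_scaleR_def
      by (intro integral_eq_nn_integral) auto
    also have "(\<integral>\<^sup>+\<omega>. ennreal (indicator B \<omega> * indicator ?A \<omega>) \<partial>M) =
      (\<integral>\<^sup>+\<omega>. indicator C (Y \<omega>) * indicator X (F (Y \<omega>, W \<omega>)) \<partial>M)"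
      by (intro nn_integral_cong) (auto simp: B split: split_indicator)
    also note eq
    also have "(\<integral>\<^sup>+\<omega>. indicator C (Y \<omega>) * \<kappa> (Y \<omega>) \<partial>M) =
        (\<integral>\<^sup>+\<omega>. ennreal (indicator B \<omega> * p (Y \<omega>)) \<partial>M)"
      by (intro nn_integral_cong) (auto simp: B \<kappa>_p split: split_indicator)
    also have "enn2real \<dots> = (\<integral>\<omega>\<in>B. p (Y \<omega>) \<partial>M)"
      unfolding set_lebesgue_integral_def B real_scaleR_def
      by (intro integral_eq_nn_integral[symmetric]) (auto simp: p_nonneg)
    finally show "(\<integral>\<omega>\<in>B. indicator ?A \<omega> \<partial>M) = (\<integral>\<omega>\<in>B. p (Y \<omega>) \<partial>M)" .
  next
    show "integrable M (indicator ?A :: 'a \<Rightarrow> real)"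
      by (intro integrable_real_indicator) (auto simp: emeasure_eq_measure)
    show "integrable M (\<lambda>\<omega>. p (Y \<omega>))"
      by (rule integrable_const_bound[of _ 1]) (auto simp: p_nonneg p_le)
    show "(\<lambda>\<omega>. p (Y \<omega>)) \<in> borel_measurable G"
      using measurable_compose[OF YG p_meas] .
  qed
  then show ?thesis by (simp add: cond_prob_given_def G_def p_def)
qed

section \<open>The Markov property of the predictions\<close>

definition pred_step :: "('n::finite, 'm::finite, 'd::finite, 'o) smpc \<Rightarrow> real ^ 'm
    \<Rightarrow> (real ^ 'n) \<times> (real ^ 'd) \<Rightarrow> real ^ 'n" where
  "pred_step S u p = dyn S (fst p, policy S (fst p, u), snd p)"

text \<open>An explicit version of the conditional probability in the chance constraint, as a
  function of the current state. It turns the constraint into an almost sure property of one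
  predicted state.\<close>

definition safe_prob :: "('n::finite, 'm::finite, 'd::finite, 'o) smpc \<Rightarrow> real ^ 'm
    \<Rightarrow> real ^ 'n \<Rightarrow> real" where
  "safe_prob S u y =
     measure (noise_law S) {w \<in> space (noise_law S). pred_step S u (y, w) \<in> state_set S}"

text \<open>Explicit factorization through the first \<open>n\<close> disturbances, which yields independence of
  the \<open>n\<close>-th one and is stable under one step of the dynamics.\<close>

definition history_dependent :: "('n::finite, 'm::finite, 'd::finite, 'o) smpc \<Rightarrow> nat
    \<Rightarrow> ('o \<Rightarrow> real ^ 'n) \<Rightarrow> bool" where
  "history_dependent S n Y \<longleftrightarrow>
     (\<exists>h \<in> borel_measurable (PiM {..<n} (\<lambda>_. noise_law S)).
        \<forall>\<omega>\<in>space (prob_sp S). Y \<omega> = h (\<lambda>j\<in>{..<n}. noise S j \<omega>))"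

section \<open>Probability spaces and measurability of the model data\<close>

locale smpc_model =
  fixes S :: "('n::finite, 'm::finite, 'd::finite, 'o) smpc"
  assumes model: "smpc_setup S"
begin

abbreviation "M \<equiv> prob_sp S"
abbreviation "\<nu> \<equiv> noise_law S"

sublocale prob_space M
  using model by (simp add: smpc_setup_def iid_noise_def)

lemma indep_noise: "indep_vars (\<lambda>_. \<nu>) (noise S) UNIV"
  using model by (simp add: smpc_setup_def iid_noise_def)

lemma noise_measurable[measurable]: "noise S k \<in> M \<rightarrow>\<^sub>M \<nu>"
  using indep_noise by (simp add: indep_vars_def)

lemma distr_noise: "distr M \<nu> (noise S k) = \<nu>"
  using model by (simp add: smpc_setup_def iid_noise_def)

sublocale law: prob_space \<nu>
  using prob_space_distr[OF noise_measurable] distr_noise by metis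

lemma noise_in_set: "\<omega> \<in> space M \<Longrightarrow> noise S k \<omega> \<in> noise_set S"
  using measurable_space[OF noise_measurable] model
  by (auto simp: smpc_setup_def iid_noise_def)

text \<open>The law lives on the trace sigma-algebra of \<open>noise_set S\<close>, so this map is
  the inclusion into the whole space, a restriction of the identity.\<close>

lemma ident_measurable_law[measurable]: "(\<lambda>w. w) \<in> \<nu> \<rightarrow>\<^sub>M borel"
proof -
  have "sets \<nu> = sets (restrict_space borel (noise_set S))"
    using model by (simp add: smpc_setup_def iid_noise_def)
  then show ?thesis
    using measurable_cong_sets[OF _ refl] measurable_restrict_space1[OF measurable_ident_sets[OF refl]]
    by blast
qed

lemma dyn_measurable: "dyn S \<in> borel_measurable borel"
  using model by (intro borel_measurable_continuous_onI) (simp add: smpc_setup_def)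

lemma stage_cost_measurable: "stage_cost S \<in> borel_measurable borel"
  using model by (intro borel_measurable_continuous_onI) (simp add: smpc_setup_def)

lemma stage_cost_nonneg: "0 \<le> stage_cost S z"
  using model unfolding smpc_setup_def by blast

lemma policy_measurable[measurable]: "(\<lambda>x. policy S (x, u)) \<in> borel_measurable borel"
  using model by (simp add: smpc_setup_def)

text \<open>The feedback is left arbitrary because two kinds occur: the policies of a fixed
  parameter in the predictions, and the closed-loop feedback, whose parameter varies with the
  state.\<close>

lemma feedback_step_measurable:
  assumes [measurable]: "\<mu> \<in> borel_measurable borel"
  shows "(\<lambda>p. dyn S (fst p, \<mu> (fst p), snd p)) \<in> borel \<Otimes>\<^sub>M \<nu> \<rightarrow>\<^sub>M borel"
proof -
  have [measurable]: "snd \<in> borel \<Otimes>\<^sub>M \<nu> \<rightarrow>\<^sub>M (borel :: (real ^ 'd) measure)"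
    using measurable_compose[OF measurable_snd ident_measurable_law] .
  have "(\<lambda>p. (fst p, \<mu> (fst p), snd p)) \<in> borel \<Otimes>\<^sub>M \<nu> \<rightarrow>\<^sub>M
      (borel \<Otimes>\<^sub>M borel \<Otimes>\<^sub>M borel :: ((real ^ 'n) \<times> (real ^ 'm) \<times> (real ^ 'd)) measure)"
    by measurable
  then show ?thesis
    using dyn_measurable by (simp add: borel_prod measurable_compose)
qed

lemma pred_step_measurable[measurable]: "pred_step S u \<in> borel \<Otimes>\<^sub>M \<nu> \<rightarrow>\<^sub>M borel"
  using feedback_step_measurable[OF policy_measurable, of u] by (simp add: pred_step_def[abs_def])

lemma feedback_cost_measurable:
  assumes [measurable]: "\<mu> \<in> borel_measurable borel"
  shows "(\<lambda>x. stage_cost S (x, \<mu> x)) \<in> borel_measurable borel"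
proof -
  have "(\<lambda>x. (x, \<mu> x)) \<in> borel \<rightarrow>\<^sub>M (borel \<Otimes>\<^sub>M borel :: ((real ^ 'n) \<times> (real ^ 'm)) measure)"
    by measurable
  then show ?thesis
    using stage_cost_measurable by (simp add: borel_prod measurable_compose)
qed

lemma safe_prob_measurable[measurable]: "safe_prob S u \<in> borel_measurable borel"
proof -
  have [measurable]: "state_set S \<in> sets borel" using model by (simp add: smpc_setup_def)
  show ?thesis unfolding safe_prob_def by measurable
qed

section \<open>States determined by past disturbances\<close>

lemma history_dependent_const: "history_dependent S n (\<lambda>_. x)"
  unfolding history_dependent_def by (intro bexI[of _ "\<lambda>_. x"]) auto

text \<open>The new factorization cuts the longer history down to its first \<open>n\<close>
  entries, recovers the old state through \<open>h\<close>, and feeds entry \<open>n\<close> into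
  \<open>F\<close>.\<close>

lemma history_dependent_Suc:
  assumes Y: "history_dependent S n Y" and F[measurable]: "F \<in> borel \<Otimes>\<^sub>M \<nu> \<rightarrow>\<^sub>M borel"
    and Z: "\<And>\<omega>. \<omega> \<in> space M \<Longrightarrow> Z \<omega> = F (Y \<omega>, noise S n \<omega>)"
  shows "history_dependent S (Suc n) Z"
proof -
  obtain h where h[measurable]: "h \<in> borel_measurable (PiM {..<n} (\<lambda>_. \<nu>))"
    and hY: "\<And>\<omega>. \<omega> \<in> space M \<Longrightarrow> Y \<omega> = h (\<lambda>j\<in>{..<n}. noise S j \<omega>)"
    using Y by (auto simp: history_dependent_def)
  have r: "(\<lambda>x. restrict x {..<n}) \<in> PiM {..<Suc n} (\<lambda>_. \<nu>) \<rightarrow>\<^sub>M PiM {..<n} (\<lambda>_. \<nu>)"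
    by (rule measurable_restrict_subset) auto
  have [measurable]: "(\<lambda>x. x n) \<in> PiM {..<Suc n} (\<lambda>_. \<nu>) \<rightarrow>\<^sub>M \<nu>"
    by (rule measurable_component_singleton) simp
  have [measurable]: "(\<lambda>x. h (restrict x {..<n})) \<in> PiM {..<Suc n} (\<lambda>_. \<nu>) \<rightarrow>\<^sub>M borel"
    by (rule measurable_compose[OF r h])
  have "(\<lambda>x. F (h (restrict x {..<n}), x n)) \<in> PiM {..<Suc n} (\<lambda>_. \<nu>) \<rightarrow>\<^sub>M borel"
    by measurable
  moreover have "restrict (\<lambda>j\<in>{..<Suc n}. noise S j \<omega>) {..<n} = (\<lambda>j\<in>{..<n}. noise S j \<omega>)" for \<omega>
    by (auto simp: fun_eq_iff restrict_def)
  ultimately show ?thesis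
    unfolding history_dependent_def
    by (intro bexI[of _ "\<lambda>x. F (h (restrict x {..<n}), x n)"]) (auto simp: Z hY)
qed

text \<open>The index blocks \<open>{..<n}\<close> and \<open>{n}\<close> are disjoint, so the
  corresponding blocks of disturbances are independent; applying \<open>h\<close> to the first block
  and evaluation to the second preserves this.\<close>

lemma history_dependent_indep:
  assumes "history_dependent S n Y"
  shows "indep_pair borel Y \<nu> (noise S n)"
proof -
  obtain h where h: "h \<in> borel_measurable (PiM {..<n} (\<lambda>_. \<nu>))"
    and hY: "\<And>\<omega>. \<omega> \<in> space M \<Longrightarrow> Y \<omega> = h (\<lambda>j\<in>{..<n}. noise S j \<omega>)"
    using assms by (auto simp: history_dependent_def)
  have "indep_pair (PiM {..<n} (\<lambda>_. \<nu>)) (\<lambda>\<omega>. \<lambda>j\<in>{..<n}. noise S j \<omega>)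
      (PiM {n} (\<lambda>_. \<nu>)) (\<lambda>\<omega>. \<lambda>j\<in>{n}. noise S j \<omega>)"
    using indep_var_restrict[OF indep_noise, of "{..<n}" "{n}"]
    by (simp add: indep_pair_def indep_var_distribution_eq)
  from indep_pair_compose[OF this h measurable_component_singleton]
  have ind: "indep_pair borel (\<lambda>\<omega>. h (\<lambda>j\<in>{..<n}. noise S j \<omega>)) \<nu> (noise S n)"
    by simp
  let ?Y = "\<lambda>\<omega>. h (\<lambda>j\<in>{..<n}. noise S j \<omega>)"
  \<comment> \<open>The factorization is an identity on the space of \<open>M\<close> only, so
    independence is carried over to \<open>Y\<close> by congruence of laws.\<close>
  have d1: "distr M borel Y = distr M borel ?Y"
    using hY by (intro distr_cong) auto
  have d2: "distr M (borel \<Otimes>\<^sub>M \<nu>) (\<lambda>\<omega>. (Y \<omega>, noise S n \<omega>)) =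
      distr M (borel \<Otimes>\<^sub>M \<nu>) (\<lambda>\<omega>. (?Y \<omega>, noise S n \<omega>))"
    using hY by (intro distr_cong) auto
  have m: "Y \<in> M \<rightarrow>\<^sub>M borel \<longleftrightarrow> ?Y \<in> M \<rightarrow>\<^sub>M borel"
    using hY by (rule measurable_cong)
  show ?thesis
    using ind unfolding indep_pair_def d1 d2 m .
qed

lemma history_dependent_measurable: "history_dependent S n Y \<Longrightarrow> Y \<in> borel_measurable M"
  using history_dependent_indep by (auto simp: indep_pair_def)

lemma nn_integral_freeze:
  assumes "history_dependent S n Y" and "\<phi> \<in> borel_measurable (borel \<Otimes>\<^sub>M \<nu>)"
  shows "(\<integral>\<^sup>+\<omega>. \<phi> (Y \<omega>, noise S n \<omega>) \<partial>M) = (\<integral>\<^sup>+\<omega>. (\<integral>\<^sup>+w. \<phi> (Y \<omega>, w) \<partial>\<nu>) \<partial>M)"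
  using nn_integral_indep_pair[OF history_dependent_indep[OF assms(1)] assms(2)]
  by (simp add: distr_noise)

section \<open>One-time marginals of the predictions\<close>

lemma pred_state_Suc:
  "pred_state S t \<xi> v (Suc i) \<omega> = pred_step S (v i) (pred_state S t \<xi> v i \<omega>, noise S (t + i) \<omega>)"
  by (simp add: pred_step_def)

text \<open>Stage \<open>i\<close> consumes the disturbance \<open>t + i\<close>, exactly the first
  one that has not yet entered the history.\<close>

lemma history_dependent_pred_state:
  assumes "history_dependent S t \<xi>"
  shows "history_dependent S (t + i) (pred_state S t \<xi> v i)"
proof (induction i)
  case 0
  have "pred_state S t \<xi> v 0 = \<xi>" by (simp add: fun_eq_iff)
  then show ?case using assms by simp
next
  case (Suc i)
  show ?case
    using history_dependent_Suc[OF Suc.IH pred_step_measurable pred_state_Suc] by simp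
qed

lemma pred_state_measurable:
  "history_dependent S t \<xi> \<Longrightarrow> pred_state S t \<xi> v i \<in> borel_measurable M"
  using history_dependent_pred_state history_dependent_measurable by blast

lemma nn_integral_pred_state_Suc:
  assumes "history_dependent S t \<xi>" and [measurable]: "\<phi> \<in> borel_measurable borel"
  shows "(\<integral>\<^sup>+\<omega>. \<phi> (pred_state S t \<xi> v (Suc i) \<omega>) \<partial>M)
    = (\<integral>\<^sup>+\<omega>. (\<integral>\<^sup>+w. \<phi> (pred_step S (v i) (pred_state S t \<xi> v i \<omega>, w)) \<partial>\<nu>) \<partial>M)"
  unfolding pred_state_Suc
  by (rule nn_integral_freeze[OF history_dependent_pred_state[OF assms(1)],
        where \<phi> = "\<lambda>p. \<phi> (pred_step S (v i) p)"]) measurable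

lemma nn_integral_pred_state:
  assumes \<xi>: "history_dependent S t \<xi>" and "\<phi> \<in> borel_measurable borel"
  shows "(\<integral>\<^sup>+\<omega>. \<phi> (pred_state S t \<xi> v i \<omega>) \<partial>M)
      = (\<integral>\<^sup>+\<omega>. (\<integral>\<^sup>+\<omega>'. \<phi> (pred_state S t (\<lambda>_. \<xi> \<omega>) v i \<omega>') \<partial>M) \<partial>M)"
    and "(\<lambda>y. \<integral>\<^sup>+\<omega>. \<phi> (pred_state S t (\<lambda>_. y) v i \<omega>) \<partial>M) \<in> borel_measurable borel"
  using assms(2)
proof (induction i arbitrary: \<phi>)
  case 0
  { case 1 then show ?case by (simp add: emeasure_space_1) }
  { case 2 then show ?case by (simp add: emeasure_space_1) }
next
  case (Suc i)
  \<comment> \<open>The one-step transition operator for the parameter \<open>v i\<close>.\<close>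
  define \<psi> where "\<psi> \<phi> z = (\<integral>\<^sup>+w. \<phi> (pred_step S (v i) (z, w)) \<partial>\<nu>)"
    for \<phi> :: "real ^ 'n \<Rightarrow> ennreal" and z
  have \<psi>: "\<psi> \<phi> \<in> borel_measurable borel" if [measurable]: "\<phi> \<in> borel_measurable borel" for \<phi>
    unfolding \<psi>_def by measurable
  { case (1 \<phi>)
    show ?case
      unfolding nn_integral_pred_state_Suc[OF \<xi> 1]
        nn_integral_pred_state_Suc[OF history_dependent_const 1]
      using Suc.IH(1)[OF \<psi>[OF 1]] by (simp add: \<psi>_def) }
  { case (2 \<phi>)
    show ?case
      unfolding nn_integral_pred_state_Suc[OF history_dependent_const 2]
      using Suc.IH(2)[OF \<psi>[OF 2]] by (simp add: \<psi>_def) }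
qed

text \<open>The mixture formula is applied to the indicator of the failure set: a vanishing double
  integral of a nonnegative function has almost surely vanishing inner integrals.\<close>

lemma AE_pred_state:
  assumes \<xi>: "history_dependent S t \<xi>" and P[measurable]: "Measurable.pred borel P"
    and ae: "AE \<omega> in M. P (pred_state S t \<xi> v i \<omega>)"
  shows "AE \<omega> in M. AE \<omega>' in M. P (pred_state S t (\<lambda>_. \<xi> \<omega>) v i \<omega>')"
proof -
  have [measurable]: "pred_state S t \<xi> v i \<in> borel_measurable M" for v i
    using pred_state_measurable[OF \<xi>] .
  have [measurable]: "pred_state S t (\<lambda>_. y) v i \<in> borel_measurable M" for y
    using pred_state_measurable[OF history_dependent_const] .
  have [measurable]: "\<xi> \<in> borel_measurable M" by (rule history_dependent_measurable[OF \<xi>])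
  let ?\<phi> = "\<lambda>z. indicator {z. \<not> P z} z :: ennreal"
  have \<phi>: "?\<phi> \<in> borel_measurable borel" by measurable
  note [measurable] = nn_integral_pred_state(2)[OF \<xi> \<phi>, where v = v and i = i]
  have "(\<integral>\<^sup>+\<omega>. ?\<phi> (pred_state S t \<xi> v i \<omega>) \<partial>M) = 0"
    using ae by (subst nn_integral_0_iff_AE) (auto elim!: eventually_mono)
  then have "(\<integral>\<^sup>+\<omega>. (\<integral>\<^sup>+\<omega>'. ?\<phi> (pred_state S t (\<lambda>_. \<xi> \<omega>) v i \<omega>') \<partial>M) \<partial>M) = 0"
    by (simp only: nn_integral_pred_state(1)[OF \<xi> \<phi>])
  then have "AE \<omega> in M. (\<integral>\<^sup>+\<omega>'. ?\<phi> (pred_state S t (\<lambda>_. \<xi> \<omega>) v i \<omega>') \<partial>M) = 0"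
    by (subst (asm) nn_integral_0_iff_AE) measurable
  then show ?thesis
  proof (eventually_elim)
    case (elim \<omega>)
    then have "AE \<omega>' in M. ?\<phi> (pred_state S t (\<lambda>_. \<xi> \<omega>) v i \<omega>') = 0"
      by (subst (asm) nn_integral_0_iff_AE) measurable
    then show ?case by eventually_elim (auto split: split_indicator_asm)
  qed
qed

text \<open>The state at stage \<open>i\<close> is independent of the disturbance
  \<open>t + i\<close>, so the conditional probability equals \<open>safe_prob\<close> at that state
  almost everywhere.\<close>

lemma chance_constraint_iff:
  assumes "history_dependent S t \<xi>"
  shows "chance_constraint S t \<xi> v i \<longleftrightarrow>
    (AE \<omega> in M. 1 - risk S \<le> safe_prob S (v i) (pred_state S t \<xi> v i \<omega>))"
proof -
  have X: "state_set S \<in> sets borel" using model by (simp add: smpc_setup_def)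
  have "AE \<omega> in M. cond_prob_given M (pred_state S t \<xi> v i)
      {\<omega> \<in> space M. pred_state S t \<xi> v (Suc i) \<omega> \<in> state_set S} \<omega>
      = safe_prob S (v i) (pred_state S t \<xi> v i \<omega>)"
    using cond_prob_given_indep_pair[OF
        history_dependent_indep[OF history_dependent_pred_state[OF assms]]
        pred_step_measurable X, of v i "v i"]
    unfolding pred_state_Suc safe_prob_def distr_noise .
  then show ?thesis
    unfolding chance_constraint_def by - (rule eventually_subst, erule eventually_mono, simp)
qed

lemma pred_stage_cost_nonneg: "0 \<le> pred_stage_cost S t \<xi> v i \<omega>"
  by (simp add: pred_stage_cost_def stage_cost_nonneg)

lemma pred_stage_cost_measurable:
  assumes "history_dependent S t \<xi>"
  shows "pred_stage_cost S t \<xi> v i \<in> borel_measurable M"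
  using measurable_compose[OF pred_state_measurable[OF assms]
      feedback_cost_measurable[OF policy_measurable]]
  by (simp add: pred_stage_cost_def[abs_def] pred_input_def)

lemma nn_integral_pred_stage_cost:
  assumes "history_dependent S t \<xi>"
  shows "(\<integral>\<^sup>+\<omega>. pred_stage_cost S t \<xi> v i \<omega> \<partial>M)
      = (\<integral>\<^sup>+\<omega>. (\<integral>\<^sup>+\<omega>'. pred_stage_cost S t (\<lambda>_. \<xi> \<omega>) v i \<omega>' \<partial>M) \<partial>M)"
    and "(\<lambda>\<omega>. \<integral>\<^sup>+\<omega>'. pred_stage_cost S t (\<lambda>_. \<xi> \<omega>) v i \<omega>' \<partial>M) \<in> borel_measurable M"
proof -
  have \<phi>: "(\<lambda>z. ennreal (stage_cost S (z, policy S (z, v i)))) \<in> borel_measurable borel"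
    using feedback_cost_measurable[OF policy_measurable] by measurable
  show "(\<integral>\<^sup>+\<omega>. pred_stage_cost S t \<xi> v i \<omega> \<partial>M)
      = (\<integral>\<^sup>+\<omega>. (\<integral>\<^sup>+\<omega>'. pred_stage_cost S t (\<lambda>_. \<xi> \<omega>) v i \<omega>' \<partial>M) \<partial>M)"
    unfolding pred_stage_cost_def pred_input_def by (rule nn_integral_pred_state(1)[OF assms \<phi>])
  show "(\<lambda>\<omega>. \<integral>\<^sup>+\<omega>'. pred_stage_cost S t (\<lambda>_. \<xi> \<omega>) v i \<omega>' \<partial>M) \<in> borel_measurable M"
    unfolding pred_stage_cost_def pred_input_def
    by (rule measurable_compose[OF history_dependent_measurable[OF assms]
          nn_integral_pred_state(2)[OF assms \<phi>]])
qed

section \<open>The descent inequality\<close>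

lemma admissible_realization:
  assumes \<xi>: "history_dependent S t \<xi>" and adm: "admissible S N Nt t \<xi> v"
  shows "AE \<omega> in M. admissible S N Nt t (\<lambda>_. \<xi> \<omega>) v"
proof -
  have [measurable]: "input_set S \<in> sets borel"
    using model by (simp add: smpc_setup_def)
  have "AE \<omega> in M. AE \<omega>' in M. pred_input S t (\<lambda>_. \<xi> \<omega>) v i \<omega>' \<in> input_set S" if "i < N" for i
    unfolding pred_input_def using adm that
    by (intro AE_pred_state[OF \<xi>]) (auto simp: admissible_def pred_input_def)
  moreover have "AE \<omega> in M. integrable M (pred_stage_cost S t (\<lambda>_. \<xi> \<omega>) v i)" if "i < N" for i
  proof -
    \<comment> \<open>The expected cost from the random start is finite, so its inner integral is
      finite for almost every start; for nonnegative costs this is integrability.\<close>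
    have "integrable M (pred_stage_cost S t \<xi> v i)" using adm that by (simp add: admissible_def)
    then have "(\<integral>\<^sup>+\<omega>. pred_stage_cost S t \<xi> v i \<omega> \<partial>M) \<noteq> \<infinity>"
      by (simp add: nn_integral_eq_integral pred_stage_cost_nonneg)
    then have "AE \<omega> in M. (\<integral>\<^sup>+\<omega>'. pred_stage_cost S t (\<lambda>_. \<xi> \<omega>) v i \<omega>' \<partial>M) \<noteq> \<infinity>"
      unfolding nn_integral_pred_stage_cost(1)[OF \<xi>]
      by (intro nn_integral_PInf_AE nn_integral_pred_stage_cost(2)[OF \<xi>]) simp
    then show ?thesis
      by eventually_elim (intro integrableI_nonneg pred_stage_cost_measurable
          history_dependent_const, auto simp: pred_stage_cost_nonneg less_top)
  qed
  moreover have "AE \<omega> in M. chance_constraint S t (\<lambda>_. \<xi> \<omega>) v i" if "i \<le> N - Nt" for i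
    unfolding chance_constraint_iff[OF history_dependent_const] using adm that
    by (intro AE_pred_state[OF \<xi>]) (auto simp: admissible_def chance_constraint_iff[OF \<xi>])
  \<comment> \<open>The exceptional null sets depend on the stage, and countably many of them are
    united.\<close>
  ultimately show ?thesis
    by (simp add: admissible_def AE_all_countable AE_conj_iff)
qed

section \<open>Objective and value function\<close>

lemma objective_eq:
  assumes "admissible S N Nt t \<xi> v"
  shows "objective S N t \<xi> v = (\<Sum>i<N. \<integral>\<omega>. pred_stage_cost S t \<xi> v i \<omega> \<partial>M)"
  using assms by (simp add: objective_def admissible_def)

lemma objective_nonneg: "0 \<le> objective S N t \<xi> v"
  unfolding objective_def by (intro Bochner_Integration.integral_nonneg sum_nonneg pred_stage_cost_nonneg)

text \<open>Integrability is part of admissibility; this makes the Bochner and the nonnegative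
  integral of each stage cost agree.\<close>

lemma ennreal_objective:
  assumes "admissible S N Nt t \<xi> v"
  shows "ennreal (objective S N t \<xi> v) = (\<Sum>i<N. \<integral>\<^sup>+\<omega>. pred_stage_cost S t \<xi> v i \<omega> \<partial>M)"
proof -
  have "ennreal (objective S N t \<xi> v) = (\<Sum>i<N. ennreal (\<integral>\<omega>. pred_stage_cost S t \<xi> v i \<omega> \<partial>M))"
    unfolding objective_eq[OF assms]
    by (rule sum_ennreal[symmetric]) (intro Bochner_Integration.integral_nonneg pred_stage_cost_nonneg)
  also have "\<dots> = (\<Sum>i<N. \<integral>\<^sup>+\<omega>. pred_stage_cost S t \<xi> v i \<omega> \<partial>M)"
    using assms by (intro sum.cong refl nn_integral_eq_integral[symmetric])
      (auto simp: admissible_def pred_stage_cost_nonneg)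
  finally show ?thesis .
qed

text \<open>Costs are nonnegative, so \<open>0\<close> bounds the objective values from below and
  the real infimum is a genuine lower bound.\<close>

lemma val_fun_le_objective:
  assumes "admissible S N Nt t (\<lambda>_. x) v"
  shows "val_fun S N Nt t x \<le> objective S N t (\<lambda>_. x) v"
  unfolding val_fun_def using assms
  by (intro cINF_lower bdd_belowI2[of _ 0]) (auto intro: objective_nonneg)

lemma val_fun_eq_objective:
  assumes "optimizer S N Nt t (\<lambda>_. x) v"
  shows "val_fun S N Nt t x = objective S N t (\<lambda>_. x) v"
proof (rule antisym)
  have adm: "admissible S N Nt t (\<lambda>_. x) v"
    using assms by (simp add: optimizer_def is_arg_min_def)
  then show "val_fun S N Nt t x \<le> objective S N t (\<lambda>_. x) v" by (rule val_fun_le_objective)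
  show "objective S N t (\<lambda>_. x) v \<le> val_fun S N Nt t x"
    unfolding val_fun_def using assms adm
    by (intro cINF_greatest) (auto simp: optimizer_def is_arg_min_linorder)
qed

text \<open>One parameter sequence is admissible from almost every realization, so its objective
  there bounds the value; averaging these objectives gives back the objective from the random start.
  The nonnegative integral is monotone for arbitrary integrands, measurable or not.\<close>

lemma nn_integral_val_fun_le:
  assumes \<xi>: "history_dependent S t \<xi>" and adm: "admissible S N Nt t \<xi> v"
  shows "(\<integral>\<^sup>+\<omega>. val_fun S N Nt t (\<xi> \<omega>) \<partial>M) \<le> ennreal (objective S N t \<xi> v)"
proof -
  have "(\<integral>\<^sup>+\<omega>. val_fun S N Nt t (\<xi> \<omega>) \<partial>M) \<le>
      (\<integral>\<^sup>+\<omega>. (\<Sum>i<N. \<integral>\<^sup>+\<omega>'. pred_stage_cost S t (\<lambda>_. \<xi> \<omega>) v i \<omega>' \<partial>M) \<partial>M)"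
    using admissible_realization[OF \<xi> adm]
    by (intro nn_integral_mono_AE, eventually_elim)
      (simp add: val_fun_le_objective ennreal_leI flip: ennreal_objective)
  also have "\<dots> = ennreal (objective S N t \<xi> v)"
    unfolding ennreal_objective[OF adm] nn_integral_pred_stage_cost(1)[OF \<xi>]
    by (intro nn_integral_sum nn_integral_pred_stage_cost(2)[OF \<xi>])
  finally show ?thesis .
qed

section \<open>The shifted candidate\<close>

text \<open>For \<open>L = N - Nt\<close> the stages are \<open>v 1, ..., v L\<close> and then
  \<open>u 0, ..., u (Nt - 1)\<close>, altogether \<open>N\<close>; the \<open>Nt\<close> parameters
  of \<open>u\<close> replace the last \<open>Nt - 1\<close> of \<open>v\<close>.\<close>

definition shifted :: "nat \<Rightarrow> (nat \<Rightarrow> real ^ 'm) \<Rightarrow> (nat \<Rightarrow> real ^ 'm) \<Rightarrow> nat \<Rightarrow> real ^ 'm" where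
  "shifted L v u i = (if i < L then v (Suc i) else u (i - L))"

text \<open>Stage \<open>i\<close> of the later problem and stage \<open>Suc i\<close> of the
  earlier transition lead on with the same disturbance, since \<open>Suc k + i = k + Suc i\<close>,
  so the paths agree pointwise. The value \<open>i = L\<close> is included because the state at
  stage \<open>L\<close> uses only parameters below \<open>L\<close>.\<close>

lemma pred_state_shifted:
  "i \<le> L \<Longrightarrow> pred_state S (Suc k) (pred_state S k \<xi> v (Suc 0)) (shifted L v u) i
    = pred_state S k \<xi> v (Suc i)"
proof (induction i)
  case (Suc i)
  then show ?case by (intro ext) (simp add: shifted_def)
qed (simp add: fun_eq_iff)

text \<open>The two predictions are glued at stage \<open>L\<close>, which
  \<open>pred_state_shifted\<close> just reaches; from there on parameters and disturbances
  coincide.\<close>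

lemma pred_state_shifted_tail:
  "pred_state S (Suc k) (pred_state S k \<xi> v (Suc 0)) (shifted L v u) (L + j)
    = pred_state S (k + (L + 1)) (pred_state S k \<xi> v (L + 1)) u j"
proof (induction j)
  case 0
  show ?case using pred_state_shifted[of L L k \<xi> v u] by (intro ext) (simp del: pred_state.simps(2))
next
  case (Suc j)
  then show ?case by (intro ext) (simp add: shifted_def del: pred_state.simps(2)
      add: pred_state_Suc[of _ _ _ "L + j"] pred_state_Suc[of _ _ _ j] add.assoc)
qed

lemma pred_input_shifted:
  "i < L \<Longrightarrow> pred_input S (Suc k) (pred_state S k \<xi> v (Suc 0)) (shifted L v u) i
    = pred_input S k \<xi> v (Suc i)"
  by (intro ext, simp only: pred_input_def pred_state_shifted less_imp_le) (simp add: shifted_def)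

lemma pred_input_shifted_tail:
  "pred_input S (Suc k) (pred_state S k \<xi> v (Suc 0)) (shifted L v u) (L + j)
    = pred_input S (k + (L + 1)) (pred_state S k \<xi> v (L + 1)) u j"
  by (intro ext, simp only: pred_input_def pred_state_shifted_tail) (simp add: shifted_def)

lemma pred_stage_cost_shifted:
  "i < L \<Longrightarrow> pred_stage_cost S (Suc k) (pred_state S k \<xi> v (Suc 0)) (shifted L v u) i
    = pred_stage_cost S k \<xi> v (Suc i)"
  by (intro ext, simp only: pred_stage_cost_def pred_input_shifted pred_state_shifted less_imp_le)

lemma pred_stage_cost_shifted_tail:
  "pred_stage_cost S (Suc k) (pred_state S k \<xi> v (Suc 0)) (shifted L v u) (L + j)
    = pred_stage_cost S (k + (L + 1)) (pred_state S k \<xi> v (L + 1)) u j"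
  by (intro ext, simp only: pred_stage_cost_def pred_input_shifted_tail pred_state_shifted_tail)

text \<open>The new chance constraints cover the stages \<open>0\<close> to \<open>N - Nt\<close>.
  Those below \<open>N - Nt\<close> are old ones moved by one stage, and the last is the first-step
  constraint of the tail problem.\<close>

lemma admissible_shifted:
  assumes "0 < Nt" "Nt < N" and head: "admissible S N Nt k \<xi> v"
    and tail: "admissible S Nt Nt (k + (N - Nt + 1)) (pred_state S k \<xi> v (N - Nt + 1)) u"
  shows "admissible S N Nt (Suc k) (pred_state S k \<xi> v (Suc 0)) (shifted (N - Nt) v u)"
proof -
  define L where "L = N - Nt"
  let ?\<xi> = "pred_state S k \<xi> v (Suc 0)" and ?w = "shifted L v u"
  have split: thesis if "i < L \<Longrightarrow> Suc i < N \<Longrightarrow> thesis" "\<And>j. i = L + j \<Longrightarrow> j < Nt \<Longrightarrow> thesis" "i < N"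
    for i thesis
    using that(1) that(2)[of "i - L"] that(3) assms(1,2) by (cases "i < L") (auto simp: L_def)
  have "AE \<omega> in M. pred_input S (Suc k) ?\<xi> ?w i \<omega> \<in> input_set S" if "i < N" for i
    using that head tail
    by (cases rule: split[of i])
      (auto simp: admissible_def L_def pred_input_shifted pred_input_shifted_tail
        simp del: pred_state.simps)
  moreover have "integrable M (pred_stage_cost S (Suc k) ?\<xi> ?w i)" if "i < N" for i
    using that head tail
    by (cases rule: split[of i])
      (auto simp: admissible_def L_def pred_stage_cost_shifted pred_stage_cost_shifted_tail
        simp del: pred_state.simps)
  moreover have "chance_constraint S (Suc k) ?\<xi> ?w i" if "i \<le> L" for i
  proof (cases "i < L")
    case True
    then have "chance_constraint S k \<xi> v (Suc i)"
      using head by (simp add: admissible_def L_def)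
    then show ?thesis
      using True by (simp only: chance_constraint_def pred_state_shifted Suc_leI less_imp_le)
  next
    case False
    then have "i = L" using that by simp
    have "chance_constraint S (k + (L + 1)) (pred_state S k \<xi> v (L + 1)) u 0"
      using tail by (simp add: admissible_def L_def)
    \<comment> \<open>A chance constraint speaks of a state and its successor, so the gluing is used
      at tail stages \<open>0\<close> and \<open>Suc 0\<close>.\<close>
    then show ?thesis
      using pred_state_shifted_tail[of k \<xi> v L u 0] pred_state_shifted_tail[of k \<xi> v L u "Suc 0"]
      unfolding \<open>i = L\<close> chance_constraint_def by (simp only: add_0_right add_Suc_right)
  qed
  ultimately show ?thesis by (simp add: admissible_def L_def)
qed

lemma objective_shifted:
  assumes "0 < Nt" "Nt < N" and head: "admissible S N Nt k \<xi> v"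
    and tail: "admissible S Nt Nt (k + (N - Nt + 1)) (pred_state S k \<xi> v (N - Nt + 1)) u"
  shows "objective S N (Suc k) (pred_state S k \<xi> v (Suc 0)) (shifted (N - Nt) v u)
    = (\<Sum>i<N - Nt. \<integral>\<omega>. pred_stage_cost S k \<xi> v (Suc i) \<omega> \<partial>M)
    + (\<Sum>j<Nt. \<integral>\<omega>. pred_stage_cost S (k + (N - Nt + 1)) (pred_state S k \<xi> v (N - Nt + 1)) u j \<omega> \<partial>M)"
proof -
  have N: "{..<N} = {..<(N - Nt) + Nt}" using assms(2) by simp
  show ?thesis
    unfolding objective_eq[OF admissible_shifted[OF assms]] N sum_lessThan_add
      pred_stage_cost_shifted_tail
    by (intro arg_cong2[where f = plus] sum.cong refl)
      (simp add: pred_stage_cost_shifted del: pred_state.simps)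
qed

lemma pred_stage_cost_0: "pred_stage_cost S k (\<lambda>_. x) v 0 = (\<lambda>_. stage_cost S (x, policy S (x, v 0)))"
  by (simp add: fun_eq_iff pred_stage_cost_def pred_input_def)

lemma objective_ge_head:
  assumes "L \<le> N" and adm: "admissible S N Nt k \<xi> v"
  shows "(\<Sum>i<L. \<integral>\<omega>. pred_stage_cost S k \<xi> v i \<omega> \<partial>M) \<le> objective S N k \<xi> v"
  unfolding objective_eq[OF adm] using assms(1)
  by (intro sum_mono2) (auto intro!: Bochner_Integration.integral_nonneg pred_stage_cost_nonneg)

text \<open>The first of \<open>N\<close> nonnegative costs is deterministic because the measured
  state is. The bound keeps the right-hand side of the descent inequality nonnegative and dominates
  the closed-loop stage costs.\<close>

lemma stage_cost_le_val_fun: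
  assumes "0 < N" and opt: "optimizer S N Nt k (\<lambda>_. x) v"
  shows "stage_cost S (x, policy S (x, v 0)) \<le> val_fun S N Nt k x"
  using objective_ge_head[of "Suc 0" N Nt k "\<lambda>_. x" v] assms
  by (simp add: val_fun_eq_objective[OF opt] pred_stage_cost_0 prob_space optimizer_def is_arg_min_def)

lemma nn_integral_val_fun_successor:
  assumes "0 < Nt" "Nt < N" and opt: "optimizer S N Nt k (\<lambda>_. x) v"
    and tail: "admissible S Nt Nt (k + (N - Nt + 1)) (pred_state S k (\<lambda>_. x) v (N - Nt + 1)) u"
  shows "(\<integral>\<^sup>+\<omega>. val_fun S N Nt (Suc k) (pred_state S k (\<lambda>_. x) v (Suc 0) \<omega>) \<partial>M)
    \<le> ennreal (val_fun S N Nt k x - stage_cost S (x, policy S (x, v 0))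
      + (\<Sum>j<Nt. \<integral>\<omega>. pred_stage_cost S (k + (N - Nt + 1))
          (pred_state S k (\<lambda>_. x) v (N - Nt + 1)) u j \<omega> \<partial>M))"
proof -
  have head: "admissible S N Nt k (\<lambda>_. x) v"
    using opt by (simp add: optimizer_def is_arg_min_def)
  let ?c = "\<lambda>i. \<integral>\<omega>. pred_stage_cost S k (\<lambda>_. x) v i \<omega> \<partial>M"
  \<comment> \<open>The applied stage and the kept stages are the first \<open>N - Nt + 1\<close>
    terms of the optimal cost; the \<open>Nt - 1\<close> discarded terms are nonnegative.\<close>
  have "stage_cost S (x, policy S (x, v 0)) + (\<Sum>i<N - Nt. ?c (Suc i)) = (\<Sum>i<Suc (N - Nt). ?c i)"
    unfolding sum.lessThan_Suc_shift by (simp add: pred_stage_cost_0 prob_space)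
  also have "\<dots> \<le> val_fun S N Nt k x"
    unfolding val_fun_eq_objective[OF opt] using assms(1,2) by (intro objective_ge_head[OF _ head]) simp
  finally have "objective S N (Suc k) (pred_state S k (\<lambda>_. x) v (Suc 0)) (shifted (N - Nt) v u)
    \<le> val_fun S N Nt k x - stage_cost S (x, policy S (x, v 0))
      + (\<Sum>j<Nt. \<integral>\<omega>. pred_stage_cost S (k + (N - Nt + 1))
          (pred_state S k (\<lambda>_. x) v (N - Nt + 1)) u j \<omega> \<partial>M)"
    unfolding objective_shifted[OF assms(1,2) head tail] by linarith
  moreover have "history_dependent S (Suc k) (pred_state S k (\<lambda>_. x) v (Suc 0))"
    using history_dependent_pred_state[OF history_dependent_const, where t = k and i = "Suc 0"]
    by (simp del: pred_state.simps)
  note nn_integral_val_fun_le[OF this admissible_shifted[OF assms(1,2) head tail]]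
  ultimately show ?thesis using ennreal_leI order_trans by blast
qed

section \<open>Geometric bounds and the descent constants\<close>

lemma origin_costs_nonneg:
  assumes "origin_costs S N Nt vs l0" "i \<le> N"
  shows "0 \<le> l0 i"
proof (cases "i \<le> N - Nt")
  case True
  then have "l0 i = opt_stage_cost S vs i 0 0"
    using assms(1) by (simp add: origin_costs_def)
  then show ?thesis
    by (simp add: opt_stage_cost_def pred_stage_cost_nonneg)
next
  case False
  obtain v where "\<forall>j<Nt. l0 (N - Nt + 1 + j) = tail_stage_cost S N Nt vs 0 0 v j"
    using assms(1) unfolding origin_costs_def by blast
  moreover have "i - (N - Nt + 1) < Nt" "N - Nt + 1 + (i - (N - Nt + 1)) = i"
    using False assms(2) by auto
  ultimately have "l0 i = tail_stage_cost S N Nt vs 0 0 v (i - (N - Nt + 1))" by metis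
  then show ?thesis by (simp add: tail_stage_cost_def pred_stage_cost_nonneg)
qed

text \<open>Summing the controllability bounds over the tail and inserting the bound on the cost at
  stage \<open>N - Nt\<close> gives the tail cost at most \<open>(1 - \<alpha>)\<close> times the
  current stage cost plus \<open>c2\<close>.\<close>

lemma nn_integral_val_fun_descent:
  assumes "0 < Nt" "Nt < N" and opt: "optimizer S N Nt k (\<lambda>_. x) (vs k x)"
    and cc: "cost_controllable S N Nt vs Xd C1 \<sigma>1 C2 \<sigma>2 l0" and x: "x \<in> Xd"
    and \<alpha>: "\<alpha> = 1 - C1 * C2 * \<sigma>1 ^ (N - Nt + 1) * ((1 - \<sigma>2 ^ Nt) / (1 - \<sigma>2))"
    and c2: "c2 = max 1 (C2 * \<sigma>1 * ((1 - \<sigma>2 ^ Nt) / (1 - \<sigma>2))) * (\<Sum>i=0..N. l0 i)"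
  shows "(\<integral>\<^sup>+\<omega>. val_fun S N Nt (Suc k) (dyn S (x, mpc_input S vs k x, noise S k \<omega>)) \<partial>M)
    \<le> ennreal (val_fun S N Nt k x - \<alpha> * stage_cost S (x, mpc_input S vs k x) + c2)"
proof -
  define L where "L = N - Nt"
  define s where "s = stage_cost S (x, mpc_input S vs k x)"
  define \<Lambda> where "\<Lambda> = opt_stage_cost S vs L k x"
  define \<gamma> where "\<gamma> = (\<Sum>j<Nt. \<sigma>2 ^ j)"
  have pos: "0 < C2" "0 < \<sigma>1" "0 < \<sigma>2" "\<sigma>2 < 1" and oc: "origin_costs S N Nt vs l0"
    using cc by (auto simp: cost_controllable_def)
  obtain u where tail: "admissible S Nt Nt (k + (N - Nt + 1)) (tail_start S N Nt vs k x) u"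
    and u: "\<And>j. j < Nt \<Longrightarrow> tail_stage_cost S N Nt vs k x u j
       \<le> C2 * \<sigma>1 * \<sigma>2 ^ j * \<Lambda> + l0 (N - Nt + 1 + j) + 1 / real Nt * (\<Sum>r<L. l0 r)"
    and \<Lambda>: "\<Lambda> \<le> C1 * \<sigma>1 ^ L * s + l0 L"
    using cc x unfolding cost_controllable_def \<Lambda>_def L_def s_def by blast
  have \<gamma>: "(1 - \<sigma>2 ^ Nt) / (1 - \<sigma>2) = \<gamma>"
    using pos by (simp add: \<gamma>_def sum_gp_strict)
  have \<gamma>_nonneg: "0 \<le> \<gamma>" using pos by (auto simp: \<gamma>_def intro!: sum_nonneg)
  \<comment> \<open>All origin terms except \<open>l0 L\<close>, which enters separately through the
    bound on \<open>\<Lambda>\<close>.\<close>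
  define R where "R = (\<Sum>r<L. l0 r) + (\<Sum>j<Nt. l0 (L + 1 + j))"
  have R_nonneg: "0 \<le> R"
    unfolding R_def L_def using assms(2)
    by (intro add_nonneg_nonneg sum_nonneg origin_costs_nonneg[OF oc]) auto
  have l0L: "0 \<le> l0 L"
    unfolding L_def by (rule origin_costs_nonneg[OF oc]) simp
  have sum_l0: "(\<Sum>i=0..N. l0 i) = l0 L + R"
  proof -
    have "{0..N} = {..<L + 1 + Nt}" using assms(2) by (auto simp: L_def)
    then show ?thesis by (simp only: sum_lessThan_add R_def) simp
  qed
  have "(\<Sum>j<Nt. tail_stage_cost S N Nt vs k x u j) \<le>
     (\<Sum>j<Nt. C2 * \<sigma>1 * \<sigma>2 ^ j * \<Lambda> + l0 (L + 1 + j) + 1 / real Nt * (\<Sum>r<L. l0 r))"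
    using u by (intro sum_mono) (simp add: L_def)
  \<comment> \<open>The \<open>Nt\<close> copies of the averaged term add up to one full sum of
    \<open>l0 r\<close> over \<open>r < L\<close>.\<close>
  also have "\<dots> = C2 * \<sigma>1 * \<gamma> * \<Lambda> + R"
    using assms(1) by (simp add: sum.distrib R_def \<gamma>_def sum_distrib_left sum_distrib_right)
  also have "\<dots> \<le> C2 * \<sigma>1 * \<gamma> * (C1 * \<sigma>1 ^ L * s + l0 L) + R"
    using pos \<gamma>_nonneg \<Lambda> by (intro add_right_mono mult_left_mono) auto
  \<comment> \<open>The two powers of \<open>\<sigma>1\<close> combine to the exponent
    \<open>L + 1\<close>, so the coefficient of \<open>s\<close> is exactly
    \<open>1 - \<alpha>\<close>.\<close>
  also have "\<dots> = (1 - \<alpha>) * s + (C2 * \<sigma>1 * \<gamma> * l0 L + 1 * R)"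
    by (simp add: \<alpha> \<gamma> L_def algebra_simps)
  \<comment> \<open>The maximum in \<open>c2\<close> dominates both coefficients,
    \<open>C2 * \<sigma>1 * \<gamma>\<close> of \<open>l0 L\<close> and \<open>1\<close> of
    \<open>R\<close>.\<close>
  also have "\<dots> \<le> (1 - \<alpha>) * s + (max 1 (C2 * \<sigma>1 * \<gamma>) * l0 L + max 1 (C2 * \<sigma>1 * \<gamma>) * R)"
    using R_nonneg l0L by (intro add_left_mono add_mono mult_right_mono) auto
  also have "\<dots> = (1 - \<alpha>) * s + c2"
    by (simp add: c2 \<gamma> sum_l0 distrib_left)
  finally have "(\<Sum>j<Nt. tail_stage_cost S N Nt vs k x u j) \<le> (1 - \<alpha>) * s + c2" .
  then have "val_fun S N Nt k x - s + (\<Sum>j<Nt. tail_stage_cost S N Nt vs k x u j)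
      \<le> val_fun S N Nt k x - \<alpha> * s + c2"
    by (simp add: algebra_simps)
  note ennreal_leI[OF this]
  moreover have "(\<integral>\<^sup>+\<omega>. val_fun S N Nt (Suc k) (dyn S (x, mpc_input S vs k x, noise S k \<omega>)) \<partial>M)
    \<le> ennreal (val_fun S N Nt k x - s + (\<Sum>j<Nt. tail_stage_cost S N Nt vs k x u j))"
    using nn_integral_val_fun_successor[OF assms(1,2) opt tail[unfolded tail_start_def]]
    unfolding tail_stage_cost_def tail_start_def s_def mpc_input_def by simp
  ultimately show ?thesis unfolding s_def by (rule order_trans[rotated])
qed

section \<open>The average closed-loop cost\<close>

text \<open>A Lyapunov argument for any continuous \<open>V\<close> with the descent property: at
  each time the fresh disturbance is independent of the current state, so the inequality can be
  integrated along the closed loop, telescoped and divided by the number of steps.\<close>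

lemma avg_closed_loop_cost_le:
  assumes Xd: "compact Xd" and V: "\<And>k. continuous_on Xd (V k)"
    and inv: "\<And>k x w. x \<in> Xd \<Longrightarrow> w \<in> noise_set S \<Longrightarrow> dyn S (x, mpc_input S vs k x, w) \<in> Xd"
    and meas: "\<And>k. mpc_input S vs k \<in> borel_measurable (restrict_space borel Xd)"
    and lower: "\<And>k x. x \<in> Xd \<Longrightarrow> stage_cost S (x, mpc_input S vs k x) \<le> V k x"
    and descent: "\<And>k x. x \<in> Xd \<Longrightarrow>
      (\<integral>\<^sup>+\<omega>. V (Suc k) (dyn S (x, mpc_input S vs k x, noise S k \<omega>)) \<partial>M)
        \<le> ennreal (V k x - \<alpha> * stage_cost S (x, mpc_input S vs k x) + c)"
    and \<alpha>: "0 < \<alpha>" "\<alpha> \<le> 1" and c: "0 \<le> c" and x0: "x0 \<in> Xd"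
  shows "avg_closed_loop_cost S vs x0 \<le> ereal (c / \<alpha>)"
proof -
  let ?x = "closed_loop S vs x0"
  have in_Xd: "?x k \<omega> \<in> Xd" if "\<omega> \<in> space M" for k \<omega>
    by (induction k) (auto simp: x0 intro!: inv noise_in_set that)
  \<comment> \<open>Feedback and value are controlled on \<open>Xd\<close> only. Extension by
    \<open>0\<close> makes them Borel on the whole space, and the closed loop never leaves
    \<open>Xd\<close>.\<close>
  define \<mu> where "\<mu> k y = (if y \<in> Xd then mpc_input S vs k y else 0)" for k y
  define V' where "V' k y = (if y \<in> Xd then V k y else 0)" for k y
  have Xd_sets[measurable]: "Xd \<in> sets borel" using Xd by (simp add: borel_compact)
  have \<mu>[measurable]: "\<mu> k \<in> borel_measurable borel" for k
    unfolding \<mu>_def using meas[of k] Xd_sets by (subst (asm) measurable_restrict_space_iff[of _ _ 0]) auto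
  have V'[measurable]: "V' k \<in> borel_measurable borel" for k
    unfolding V'_def using borel_measurable_continuous_on_restrict[OF V[of k]] Xd_sets
    by (subst (asm) measurable_restrict_space_iff[of _ _ 0]) auto
  define F where "F k p = dyn S (fst p, \<mu> k (fst p), snd p)" for k p
  have F[measurable]: "F k \<in> borel \<Otimes>\<^sub>M \<nu> \<rightarrow>\<^sub>M borel" for k
    unfolding F_def by (rule feedback_step_measurable[OF \<mu>])
  have x_Suc: "?x (Suc k) \<omega> = F k (?x k \<omega>, noise S k \<omega>)" if "\<omega> \<in> space M" for k \<omega>
    using in_Xd[OF that, of k] by (simp add: F_def \<mu>_def)
  have hist: "history_dependent S k (?x k)" for k
  proof (induction k)
    case 0
    have "?x 0 = (\<lambda>_. x0)" by (simp add: fun_eq_iff)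
    then show ?case by (simp add: history_dependent_const)
  next
    case (Suc k)
    then show ?case by (rule history_dependent_Suc[OF _ F x_Suc])
  qed
  have x_meas[measurable]: "?x k \<in> borel_measurable M" for k
    by (rule history_dependent_measurable[OF hist])
  define b where "b k \<omega> = stage_cost S (?x k \<omega>, mpc_input S vs k (?x k \<omega>))" for k \<omega>
  \<comment> \<open>A continuous function on the compact set \<open>Xd\<close> is bounded, and the
    state stays there.\<close>
  have V_int: "integrable M (\<lambda>\<omega>. V k (?x k \<omega>))" for k
  proof -
    obtain B where "\<And>y. y \<in> Xd \<Longrightarrow> norm (V k y) \<le> B"
      using compact_imp_bounded[OF compact_continuous_image[OF V Xd, of k]]
      by (auto simp: bounded_iff)
    then have "integrable M (\<lambda>\<omega>. V' k (?x k \<omega>))"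
      by (intro integrable_const_bound[of _ B] AE_I2) (simp_all add: V'_def in_Xd, simp flip: V'_def)
    moreover have "integrable M (\<lambda>\<omega>. V' k (?x k \<omega>)) \<longleftrightarrow> integrable M (\<lambda>\<omega>. V k (?x k \<omega>))"
      by (intro Bochner_Integration.integrable_cong) (auto simp: V'_def in_Xd)
    ultimately show ?thesis by simp
  qed
  have b_nonneg: "0 \<le> b k \<omega>" for k \<omega>
    by (simp add: b_def stage_cost_nonneg)
  have b_le: "b k \<omega> \<le> V k (?x k \<omega>)" if "\<omega> \<in> space M" for k \<omega>
    unfolding b_def using lower in_Xd[OF that] by blast
  have b_int: "integrable M (b k)" for k
  proof (rule Bochner_Integration.integrable_bound[OF V_int[of k]])
    have "(\<lambda>\<omega>. stage_cost S (?x k \<omega>, \<mu> k (?x k \<omega>))) \<in> borel_measurable M"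
      by (rule measurable_compose[OF x_meas feedback_cost_measurable[OF \<mu>]])
    then show "b k \<in> borel_measurable M"
      by (rule measurable_cong[THEN iffD1, rotated]) (simp add: b_def \<mu>_def in_Xd)
    show "AE \<omega> in M. norm (b k \<omega>) \<le> norm (V k (?x k \<omega>))"
      using b_nonneg order_trans[OF b_le abs_ge_self] by (intro AE_I2) simp
  qed
  define a where "a k = (\<integral>\<omega>. V k (?x k \<omega>) \<partial>M)" for k
  have a_nonneg: "0 \<le> a k" for k
    unfolding a_def using order_trans[OF b_nonneg b_le]
    by (intro Bochner_Integration.integral_nonneg_AE AE_I2)
  have step: "a (Suc k) \<le> a k - \<alpha> * (\<integral>\<omega>. b k \<omega> \<partial>M) + c" for k
  proof -
    let ?r = "\<lambda>\<omega>. V k (?x k \<omega>) - \<alpha> * b k \<omega> + c"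
    have r_int: "integrable M ?r" using V_int b_int by simp
    \<comment> \<open>From \<open>\<alpha> \<le> 1\<close>,
      \<open>b k \<omega> \<le> V k (?x k \<omega>)\<close> and \<open>0 \<le> c\<close>; this
      allows the return from nonnegative to real integrals.\<close>
    have r_nonneg: "0 \<le> ?r \<omega>" if "\<omega> \<in> space M" for \<omega>
      using mult_right_mono[OF \<alpha>(2) b_nonneg[of k \<omega>]] b_le[OF that, of k] c by simp
    have F_eq: "F k (y, noise S k \<omega>) = dyn S (y, mpc_input S vs k y, noise S k \<omega>)"
      and F_in: "F k (y, noise S k \<omega>) \<in> Xd" if "y \<in> Xd" "\<omega> \<in> space M" for y \<omega>
      using that inv[OF _ noise_in_set, of y \<omega> k k] by (auto simp: F_def \<mu>_def)
    have "(\<integral>\<^sup>+\<omega>. V (Suc k) (?x (Suc k) \<omega>) \<partial>M)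
        = (\<integral>\<^sup>+\<omega>. V' (Suc k) (F k (?x k \<omega>, noise S k \<omega>)) \<partial>M)"
      by (intro nn_integral_cong) (simp add: V'_def F_in in_Xd x_Suc del: closed_loop.simps)
    also have "\<dots> = (\<integral>\<^sup>+\<omega>. (\<integral>\<^sup>+w. V' (Suc k) (F k (?x k \<omega>, w)) \<partial>\<nu>) \<partial>M)"
      by (rule nn_integral_freeze[OF hist, where \<phi> = "\<lambda>p. V' (Suc k) (F k p)"]) measurable
    \<comment> \<open>The integral over the law is written through a fresh sample point, with the
      current state held fixed, which is the form of \<open>descent\<close>.\<close>
    also have "\<dots> = (\<integral>\<^sup>+\<omega>. (\<integral>\<^sup>+\<omega>'. V' (Suc k) (F k (?x k \<omega>, noise S k \<omega>')) \<partial>M) \<partial>M)"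
      by (subst distr_noise[of k, symmetric], subst nn_integral_distr) measurable
    also have "\<dots> \<le> (\<integral>\<^sup>+\<omega>. ?r \<omega> \<partial>M)"
    proof (rule nn_integral_mono)
      fix \<omega> assume \<omega>: "\<omega> \<in> space M"
      have "(\<integral>\<^sup>+\<omega>'. V' (Suc k) (F k (?x k \<omega>, noise S k \<omega>')) \<partial>M) =
        (\<integral>\<^sup>+\<omega>'. V (Suc k) (dyn S (?x k \<omega>, mpc_input S vs k (?x k \<omega>), noise S k \<omega>')) \<partial>M)"
        using F_in[OF in_Xd[OF \<omega>]] F_eq[OF in_Xd[OF \<omega>]] by (intro nn_integral_cong) (simp add: V'_def)
      also have "\<dots> \<le> ennreal (?r \<omega>)"
        unfolding b_def by (rule descent[OF in_Xd[OF \<omega>]])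
      finally show "(\<integral>\<^sup>+\<omega>'. V' (Suc k) (F k (?x k \<omega>, noise S k \<omega>')) \<partial>M) \<le> ennreal (?r \<omega>)" .
    qed
    also have "\<dots> = ennreal (\<integral>\<omega>. ?r \<omega> \<partial>M)"
      using r_int r_nonneg by (intro nn_integral_eq_integral AE_I2) auto
    finally have "a (Suc k) \<le> (\<integral>\<omega>. ?r \<omega> \<partial>M)"
      unfolding a_def using r_nonneg
      by (intro integral_real_bounded Bochner_Integration.integral_nonneg_AE AE_I2)
    also have "\<dots> = a k - \<alpha> * (\<integral>\<omega>. b k \<omega> \<partial>M) + c"
      using V_int b_int by (simp add: a_def prob_space)
    finally show ?thesis .
  qed
  have telescope: "a m + \<alpha> * (\<Sum>k<m. \<integral>\<omega>. b k \<omega> \<partial>M) \<le> V 0 x0 + real m * c" for m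
  proof (induction m)
    case 0
    show ?case by (simp add: a_def prob_space)
  next
    case (Suc m)
    then show ?case using step[of m] by (simp add: algebra_simps)
  qed
  \<comment> \<open>The nonnegative term \<open>a m\<close> is dropped; the initial value then
    contributes only a term of order \<open>1 / m\<close>.\<close>
  have avg: "1 / real m * (\<Sum>k<m. \<integral>\<omega>. b k \<omega> \<partial>M) \<le> V 0 x0 / \<alpha> * (1 / real m) + c / \<alpha>"
    if "0 < m" for m
    using telescope[of m] a_nonneg[of m] \<alpha>(1) that by (simp add: field_simps)
  have "(\<lambda>m. V 0 x0 / \<alpha> * (1 / real m) + c / \<alpha>) \<longlonglongrightarrow> V 0 x0 / \<alpha> * 0 + c / \<alpha>"
    by (intro tendsto_intros lim_1_over_n)
  then have lim: "(\<lambda>m. ereal (V 0 x0 / \<alpha> * (1 / real m) + c / \<alpha>)) \<longlonglongrightarrow> ereal (c / \<alpha>)"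
    by simp
  have "avg_closed_loop_cost S vs x0 \<le> limsup (\<lambda>m. ereal (V 0 x0 / \<alpha> * (1 / real m) + c / \<alpha>))"
    unfolding avg_closed_loop_cost_def
    using avg unfolding b_def
    by (intro Limsup_mono eventually_mono[OF eventually_gt_at_top[of 0]]) (simp only: ereal_less_eq)
  also have "\<dots> = ereal (c / \<alpha>)"
    using lim by (intro lim_imp_Limsup) simp_all
  finally show ?thesis .
qed

end

text \<open>The optimizers \<open>vs\<close> are an arbitrary selection. The premise of the second
  claim makes the selected feedback measurable on \<open>Xd\<close>, so that the closed-loop states
  and their costs are random variables.\<close>

theorem mainTheorem1:
  fixes S :: "('n::finite, 'm::finite, 'd::finite, 'o) smpc"
    and N Nt :: nat
    and vs :: "nat \<Rightarrow> nat \<Rightarrow> real ^ 'n \<Rightarrow> nat \<Rightarrow> real ^ 'm"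
    and Xd :: "(real ^ 'n) set"
    and C1 C2 \<sigma>1 \<sigma>2 \<alpha> c2 :: real
    and l0 :: "nat \<Rightarrow> real"
  assumes "3 \<le> N" and "2 \<le> Nt" and "Nt \<le> N - 1"
    and "smpc_setup S"
    and "viable S N vs Xd"
    and "cost_controllable S N Nt (vs Nt) Xd C1 \<sigma>1 C2 \<sigma>2 l0"
    and "\<alpha> = 1 - C1 * C2 * \<sigma>1 ^ (N - Nt + 1) * ((1 - \<sigma>2 ^ Nt) / (1 - \<sigma>2))"
    and "c2 = max 1 (C2 * \<sigma>1 * ((1 - \<sigma>2 ^ Nt) / (1 - \<sigma>2))) * (\<Sum>i=0..N. l0 i)"
    and "0 < \<alpha>" and "\<alpha> < 1"
  shows "(\<forall>k. \<forall>x\<in>Xd.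
            (\<integral>\<omega>. val_fun S N Nt (k + 1) (dyn S (x, mpc_input S (vs Nt) k x, noise S k \<omega>)) \<partial>prob_sp S)
              - val_fun S N Nt k x
            \<le> - \<alpha> * stage_cost S (x, mpc_input S (vs Nt) k x) + c2) \<and>
         ((\<forall>k. mpc_input S (vs Nt) k \<in> borel_measurable (restrict_space borel Xd)) \<longrightarrow>
          (\<forall>x0\<in>Xd. avg_closed_loop_cost S (vs Nt) x0 \<le> ereal (c2 / \<alpha>)))"
proof -
  interpret smpc_model S by unfold_locales (rule assms(4))
  have Nt: "0 < Nt" "Nt < N" "0 < N" "2 \<le> Nt \<and> Nt \<le> N" using assms(1-3) by auto
  have opt: "optimizer S N Nt k (\<lambda>_. x) (vs Nt k x)" if "x \<in> Xd" for k x
    using assms(5) Nt(4) that by (simp add: viable_def)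
  have V: "continuous_on Xd (val_fun S N Nt k)" for k
    using assms(5) Nt(4) by (simp add: viable_def)
  have inv: "dyn S (x, mpc_input S (vs Nt) k x, w) \<in> Xd" if "x \<in> Xd" "w \<in> noise_set S" for k x w
    using assms(5) Nt(4) that by (simp add: viable_def)
  have compact: "compact Xd" using assms(5) by (simp add: viable_def)
  have lower: "stage_cost S (x, mpc_input S (vs Nt) k x) \<le> val_fun S N Nt k x" if "x \<in> Xd" for k x
    unfolding mpc_input_def by (rule stage_cost_le_val_fun[OF Nt(3) opt[OF that]])
  have descent: "(\<integral>\<^sup>+\<omega>. val_fun S N Nt (Suc k) (dyn S (x, mpc_input S (vs Nt) k x, noise S k \<omega>)) \<partial>M)
      \<le> ennreal (val_fun S N Nt k x - \<alpha> * stage_cost S (x, mpc_input S (vs Nt) k x) + c2)"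
    if "x \<in> Xd" for k x
    by (rule nn_integral_val_fun_descent[OF Nt(1,2) opt[OF that] assms(6) that assms(7,8)])
  have oc: "origin_costs S N Nt (vs Nt) l0" using assms(6) by (simp add: cost_controllable_def)
  have "0 \<le> (\<Sum>i=0..N. l0 i)" by (intro sum_nonneg origin_costs_nonneg[OF oc]) simp
  then have c2: "0 \<le> c2"
    unfolding assms(8) by (intro mult_nonneg_nonneg) (auto simp: le_max_iff_disj)
  have "(\<integral>\<omega>. val_fun S N Nt (k + 1) (dyn S (x, mpc_input S (vs Nt) k x, noise S k \<omega>)) \<partial>M)
      \<le> val_fun S N Nt k x - \<alpha> * stage_cost S (x, mpc_input S (vs Nt) k x) + c2"
    if x: "x \<in> Xd" for k x
  proof (rule integral_real_bounded)
    \<comment> \<open>A nonnegative bound is required because the Bochner integral defaults to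
      \<open>0\<close> for non-integrable functions; it follows from \<open>\<alpha> < 1\<close>,
      \<open>lower\<close> and \<open>c2\<close>.\<close>
    have "\<alpha> * stage_cost S (x, mpc_input S (vs Nt) k x) \<le> 1 * stage_cost S (x, mpc_input S (vs Nt) k x)"
      using assms(10) by (intro mult_right_mono stage_cost_nonneg) simp
    then show "0 \<le> val_fun S N Nt k x - \<alpha> * stage_cost S (x, mpc_input S (vs Nt) k x) + c2"
      using lower[OF x, of k] c2 by simp
  qed (use descent[OF x] in simp)
  then have "(\<integral>\<omega>. val_fun S N Nt (k + 1) (dyn S (x, mpc_input S (vs Nt) k x, noise S k \<omega>)) \<partial>M)
      - val_fun S N Nt k x \<le> - \<alpha> * stage_cost S (x, mpc_input S (vs Nt) k x) + c2"
    if "x \<in> Xd" for k x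
    using that by (simp add: algebra_simps)
  moreover have "avg_closed_loop_cost S (vs Nt) x0 \<le> ereal (c2 / \<alpha>)"
    if "\<forall>k. mpc_input S (vs Nt) k \<in> borel_measurable (restrict_space borel Xd)" "x0 \<in> Xd" for x0
    using that assms(9,10) c2 compact V inv lower descent
    by (intro avg_closed_loop_cost_le[where V = "val_fun S N Nt" and Xd = Xd]) auto
  ultimately show ?thesis by blast
qed

end
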